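(* Let $\Omega\subset\mathbb{R}^n$ be a domain satisfying the uniform exterior sphere condition. Then there exists a constant $1\le c_2<\infty$, depending only on $\Omega$, such that $$\frac{1}{|\Omega|}\int_{\Omega}h\,dx\le\frac{c_2}{|\partial\Omega|}\int_{\partial\Omega}h\,ds$$ for all non-negative harmonic functions $h$ in $\Omega$ taking continuous values on the boundary, and, with the same constant, $$\frac{1}{|\Omega|}\int_{\Omega}u\,dx\;\le\;\frac{c_2}{|\partial\Omega|}\int_{\partial\Omega}u\,ds$$ for every non-negative function $u$ that is subharmonic in $\Omega$ and continuous in $\overline{\Omega}$. On the other hand, there exists a sequence $(u_k)$ of positive functions, subharmonic in $\Omega$ and continuous in $\overline{\Omega}$, for which the volume averages $\frac{1}{|\Omega|}\int_\Omega u_k\,dx$ remain bounded, while the surface averages $\frac{1}{|\partial\Omega|}\int_{\partial\Omega}u_k\,ds$ are unbounded.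
   Context: $|\Omega|$ denotes the volume of $\Omega$, $|\partial\Omega|$ the surface measure of $\partial\Omega$, and $ds$ surface measure. Uniform exterior sphere condition: there is a radius $\delta>0$ such that for every $y\in\partial\Omega$ there is a closed ball $\overline{B}$ of radius $\delta$ with $\overline{B}\cap\overline{\Omega}=\{y\}$. A real-valued function $u$ defined in $\Omega$ is called subharmonic if $u$ is continuous and for every ball $B$ whose closure is contained in $\Omega$ and every function $h$ harmonic in $B$ (continuous up to $\partial B$) satisfying $h\ge u$ on $\partial B$, one has $h\ge u$ in $B$.
   Formalization: The domain Ω is additionally assumed bounded; without this the claim fails, e.g. for the tube of radius e^{-x²} about an axis in R³, which has finite volume and area but carries a positive harmonic function with zero boundary values. *)

theory Defs
  imports "HOL-Analysis.Analysis"
begin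

(* The contribution of one covering set to the s-dimensional Hausdorff measure.  The empty set is
   treated separately because 0 ^ 0 = 1: for s = 0 every nonempty set contributes 1. *)
definition hausdorff_gauge :: "nat \<Rightarrow> 'a::metric_space set \<Rightarrow> ennreal" where
  "hausdorff_gauge s C =
     (if C = {} then 0 else ennreal (unit_ball_vol (real s) * (diameter C / 2) ^ s))"

(* Boundedness is required since diameter is an unspecified real number for unbounded sets. *)
definition hausdorff_premeasure :: "nat \<Rightarrow> real \<Rightarrow> 'a::metric_space set \<Rightarrow> ennreal" where
  "hausdorff_premeasure s \<delta> A =
     (INF C \<in> {C :: nat \<Rightarrow> 'a set. A \<subseteq> (\<Union>i. C i) \<and> (\<forall>i. bounded (C i) \<and> diameter (C i) \<le> \<delta>)}.
        \<Sum>i. hausdorff_gauge s (C i))"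

definition hausdorff_outer :: "nat \<Rightarrow> 'a::metric_space set \<Rightarrow> ennreal" where
  "hausdorff_outer s A = (SUP \<delta> \<in> {0<..}. hausdorff_premeasure s \<delta> A)"

definition hausdorff_measure :: "nat \<Rightarrow> 'a::metric_space measure" where
  "hausdorff_measure s = measure_of UNIV (sets borel) (hausdorff_outer s)"

(* The factor unit_ball_vol normalises the (n-1)-dimensional Hausdorff measure so that it is
   the usual surface measure on smooth hypersurfaces. *)
definition surface_measure :: "'a::euclidean_space measure" where
  "surface_measure = hausdorff_measure (DIM('a) - 1)"

(* f is twice continuously differentiable on the open set S, with derivatives f' and f'',
   and its Laplacian, the trace of the Hessian f'', vanishes. *)
definition harmonic_on :: "'a::euclidean_space set \<Rightarrow> ('a \<Rightarrow> real) \<Rightarrow> bool" where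
  "harmonic_on S f \<longleftrightarrow>
     (\<exists>(f' :: 'a \<Rightarrow> 'a \<Rightarrow>\<^sub>L real) (f'' :: 'a \<Rightarrow> 'a \<Rightarrow>\<^sub>L 'a \<Rightarrow>\<^sub>L real).
        (\<forall>x\<in>S. (f has_derivative blinfun_apply (f' x)) (at x)) \<and>
        (\<forall>x\<in>S. (f' has_derivative blinfun_apply (f'' x)) (at x)) \<and>
        continuous_on S f'' \<and>
        (\<forall>x\<in>S. (\<Sum>b\<in>Basis. blinfun_apply (blinfun_apply (f'' x) b) b) = 0))"

definition subharmonic_on :: "'a::euclidean_space set \<Rightarrow> ('a \<Rightarrow> real) \<Rightarrow> bool" where
  "subharmonic_on S u \<longleftrightarrow>
     continuous_on S u \<and>
     (\<forall>x r h. 0 < r \<and> cball x r \<subseteq> S \<and>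
        harmonic_on (ball x r) h \<and> continuous_on (cball x r) h \<and>
        (\<forall>y\<in>sphere x r. u y \<le> h y) \<longrightarrow> (\<forall>y\<in>ball x r. u y \<le> h y))"

definition uniform_exterior_sphere :: "'a::euclidean_space set \<Rightarrow> bool" where
  "uniform_exterior_sphere S \<longleftrightarrow>
     (\<exists>\<delta>>0. \<forall>y\<in>frontier S. \<exists>z. cball z \<delta> \<inter> closure S = {y})"

end

theory Submission
  imports Defs
begin

text \<open>
  The volume integral is bounded by majorising with explicit harmonic functions. A ball of radius
  \<open>\<delta>\<close> touching \<open>closure \<Omega>\<close> from outside at \<open>y\<close> contains a slightly smaller concentric ball of radius
  \<open>\<delta> - \<rho>\<close>. With \<open>z\<close> for its centre, its Poisson kernel
  \<open>K x = ((norm (x - z))\<^sup>2 - (\<delta> - \<rho>)\<^sup>2) / norm (x - p) ^ n\<close>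
  with pole \<open>p\<close> at distance \<open>\<rho>\<close> from \<open>y\<close> is harmonic and positive on \<open>\<Omega>\<close>. It is of size at least
  \<open>\<rho> powr (1 - n)\<close> near \<open>y\<close>, up to a constant, and at most a constant times \<open>|x - p| powr (1 - n)\<close>
  throughout \<open>\<Omega>\<close>, so that its integral over \<open>\<Omega>\<close> is bounded uniformly in \<open>y\<close> and \<open>\<rho>\<close>
  (\<open>exterior_ball_kernel\<close>). Given a nonnegative subharmonic \<open>u\<close>, cover the boundary by finitely many
  balls of radii \<open>\<rho>\<^sub>i\<close> with \<open>u \<le> M\<^sub>i\<close> on the \<open>i\<close>-th one. Then a multiple of
  \<open>\<Sum>i. M\<^sub>i * \<rho>\<^sub>i ^ (n - 1) * K\<^sub>i\<close> is harmonic and majorises \<open>u\<close> on the boundary, hence in \<open>\<Omega>\<close> by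
  comparison (\<open>subharmonic_le_harmonic\<close>), and integrating it bounds the volume integral of \<open>u\<close> by a
  multiple of \<open>\<Sum>i. M\<^sub>i * \<rho>\<^sub>i ^ (n - 1)\<close> (\<open>subharmonic_integral_le_sum\<close>). Sums of exactly this
  form occur in the definition of Hausdorff measure: covering the level sets of \<open>u\<close> on the boundary
  almost optimally makes the sum at most a constant times the surface integral of \<open>u\<close>
  (\<open>compact_cover_by_majorising_balls\<close>). The radii of these coverings vary freely, and this is
  what accommodates thin cusps and horns, near which the boundary has arbitrarily small density.

  The statement divides by the surface measure of the boundary, which therefore has to be positive
  and finite. Positivity follows from the inequality for \<open>u = 1\<close>. Finiteness is a packing argument
  in the exterior: moving separated boundary points along their exterior normals keeps them
  separated, and the resulting points fill a positive proportion of a bounded region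
  (\<open>frontier_packing_bound\<close>).

  For the second half, let \<open>M\<close> be the maximum of a coordinate \<open>x \<bullet> e\<close> on \<open>closure \<Omega>\<close>. The line in
  direction \<open>e\<close> through a point of the cap \<open>{x \<in> \<Omega>. t < x \<bullet> e}\<close> leaves \<open>\<Omega>\<close> through the boundary
  of the cap, so the volume of the cap is at most a constant times \<open>M - t\<close> times its surface
  (\<open>cap_volume_le_surface\<close>). Integrating over the caps, the convex ramp \<open>max 0 (x \<bullet> e - t)\<close> has a
  volume integral that is smaller than its surface integral by a factor of order \<open>M - t\<close>
  (\<open>ramp_volume_le_surface\<close>). Ramps with \<open>t\<close> tending to \<open>M\<close>, scaled to volume integral \<open>1\<close> and
  increased by \<open>1\<close> to make them positive, form the required sequence.
\<close>

section \<open>Hausdorff measure is a measure on the Borel sets\<close>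

text \<open>
  Caratheodory's criterion for metric outer measures. For a closed set \<open>F\<close>, the part of \<open>A\<close> outside
  \<open>F\<close> is exhausted by the sets \<open>D k\<close> of points at distance at least \<open>1 / (k + 1)\<close> from \<open>F\<close>, each of
  which is separated from \<open>A \<inter> F\<close>. What the \<open>D k\<close> miss is a union of rings whose measures have a
  finite sum.
\<close>
lemma metric_outer_measure_borel:
  fixes f :: "'a::metric_space set \<Rightarrow> ennreal"
  assumes oms: "outer_measure_space (Pow UNIV) f"
    and sep: "\<And>A B d. 0 < d \<Longrightarrow> (\<And>x y. x \<in> A \<Longrightarrow> y \<in> B \<Longrightarrow> d \<le> dist x y) \<Longrightarrow> f A + f B \<le> f (A \<union> B)"
  shows "sets borel \<subseteq> lambda_system UNIV (Pow UNIV) f"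
proof -
  interpret P: sigma_algebra UNIV "Pow UNIV :: 'a set set"
    by (rule sigma_algebra_Pow)
  have mono: "f A \<le> f B" if "A \<subseteq> B" for A B
    using oms that by (auto simp: outer_measure_space_def increasing_def)
  have f0: "f {} = 0"
    using oms by (auto simp: outer_measure_space_def positive_def)
  have csub: "f (\<Union>i. A i) \<le> (\<Sum>i. f (A i))" for A :: "nat \<Rightarrow> 'a set"
  proof -
    have "f (\<Union>i. disjointed A i) \<le> (\<Sum>i. f (disjointed A i))"
      using oms disjoint_family_disjointed[of A]
      by (auto simp: outer_measure_space_def countably_subadditive_def)
    also have "\<dots> \<le> (\<Sum>i. f (A i))"
      by (intro suminf_le mono) (auto simp: disjointed_subset)
    finally show ?thesis by (simp add: UN_disjointed_eq)
  qed
  have sub2: "f (A \<union> B) \<le> f A + f B" for A B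
  proof -
    have "(\<Union>i. binaryset A B i) = A \<union> B"
      by (simp add: range_binaryset_eq)
    moreover have "(\<Sum>i. f (binaryset A B i)) = f A + f B"
      using suminf_binaryset_eq[of f A B] f0 by simp
    ultimately show ?thesis
      using csub[of "binaryset A B"] by simp
  qed
  have closed_in: "F \<in> lambda_system UNIV (Pow UNIV) f" if F: "closed F" for F
  proof (cases "F = {}")
    case True
    then show ?thesis by (simp add: P.lambda_system_eq f0 del: Pow_UNIV)
  next
    case False
    have "f (A \<inter> F) + f (A - F) \<le> f A" for A
    proof (cases "f A = \<infinity>")
      case True
      then show ?thesis by simp
    next
      case fin: False
      define D where "D k = {x \<in> A. 1 / (real k + 1) \<le> infdist x F}" for k :: nat
      define R where "R k = D (Suc k) - D k" for k
      have inv: "1 / (real k + 1) \<le> 1 / (real j + 1)" if "j \<le> k" for j k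
        using that by (simp add: frac_le)
      have D_mono: "D j \<subseteq> D k" if "j \<le> k" for j k
        using inv[OF that] by (auto simp: D_def)
      have DA: "D k \<subseteq> A" and RA: "R k \<subseteq> A" for k
        by (auto simp: D_def R_def)
      have base: "f (A \<inter> F) + f (D k) \<le> f A" for k
      proof -
        have "f (A \<inter> F) + f (D k) \<le> f (A \<inter> F \<union> D k)"
        proof (rule sep[of "1 / (real k + 1)"])
          fix x y assume "x \<in> A \<inter> F" "y \<in> D k"
          then have "1 / (real k + 1) \<le> infdist y F" "infdist y F \<le> dist y x"
            by (auto simp: D_def intro: infdist_le)
          then show "1 / (real k + 1) \<le> dist x y" by (simp add: dist_commute)
        qed auto
        also have "\<dots> \<le> f A" by (intro mono) (auto simp: D_def)
        finally show ?thesis .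
      qed
      \<comment> \<open>Among the rings of one parity, each is separated from the union of the earlier ones, so
        that their measures add up to at most the measure of the whole set.\<close>
      have ring_sum: "(\<Sum>i<m. f (R (2 * i + c))) \<le> f (D (2 * m + c - 1))" for c m :: nat
      proof (induction m)
        case 0
        then show ?case by simp
      next
        case (Suc m)
        have "f (D (2 * m + c - 1)) + f (R (2 * m + c)) \<le> f (D (2 * m + c - 1) \<union> R (2 * m + c))" if m: "m \<noteq> 0"
        proof (rule sep)
          show "0 < 1 / real (2 * m + c) - 1 / (real (2 * m + c) + 1)"
            using m by (auto intro!: frac_less2)
          fix x y assume x: "x \<in> D (2 * m + c - 1)" and y: "y \<in> R (2 * m + c)"
          have "real (2 * m + c - 1) + 1 = real (2 * m + c)"
            using m by (simp add: of_nat_diff)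
          moreover have "1 / (real (2 * m + c - 1) + 1) \<le> infdist x F"
            using x by (simp only: D_def mem_Collect_eq)
          ultimately have "1 / real (2 * m + c) \<le> infdist x F"
            by simp
          moreover have "infdist y F < 1 / (real (2 * m + c) + 1)"
            using y RA[of "2 * m + c"] unfolding R_def D_def by auto
          moreover have "infdist x F \<le> infdist y F + dist x y"
            by (rule infdist_triangle)
          ultimately show "1 / real (2 * m + c) - 1 / (real (2 * m + c) + 1) \<le> dist x y"
            by linarith
        qed
        moreover have "D (2 * m + c - 1) \<union> R (2 * m + c) \<subseteq> D (2 * Suc m + c - 1)"
          using D_mono[of "2 * m + c - 1" "2 * Suc m + c - 1"] by (auto simp: R_def)
        moreover have "(\<Sum>i<Suc m. f (R (2 * i + c))) \<le> f (D (2 * m + c - 1)) + f (R (2 * m + c))"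
          using Suc by (simp add: add_right_mono)
        moreover have "f (R (2 * m + c)) \<le> f (D (2 * Suc m + c - 1))"
          by (rule mono) (auto simp: R_def)
        ultimately show ?case
          by (cases "m = 0") (simp, blast intro: mono order_trans)
      qed
      have "(\<Sum>i<m. f (R i)) \<le> f A + f A" for m
      proof -
        have "(\<Sum>i<m. f (R i)) \<le> (\<Sum>i<2 * m. f (R i))"
          by (intro sum_mono2) auto
        also have "\<dots> = (\<Sum>i<m. f (R (2 * i + 0))) + (\<Sum>i<m. f (R (2 * i + 1)))"
          by (induction m) (simp_all add: ac_simps)
        also have "\<dots> \<le> f A + f A"
          by (intro add_mono order_trans[OF ring_sum] mono DA)
        finally show ?thesis .
      qed
      then have "(\<Sum>i. f (R i)) \<le> f A + f A"
        by (intro suminf_le_const) auto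
      then have T: "(\<Sum>i. f (R i)) < top"
        using fin by (auto simp: less_top[symmetric] top_unique)
      have tail: "f (A - F) \<le> f (D k) + (\<Sum>i. f (R (i + k)))" for k
      proof -
        have "x \<in> D k \<union> (\<Union>i. R (i + k))" if x: "x \<in> A - F" for x
        proof (cases "x \<in> D k")
          case False
          have "0 < infdist x F"
            using x F \<open>F \<noteq> {}\<close> by (metis DiffD2 in_closed_iff_infdist_zero infdist_nonneg less_eq_real_def)
          then obtain N where "1 / (real N + 1) < infdist x F"
            by (metis add.commute nat_approx_posE of_nat_Suc)
          then have "x \<in> D N" using x by (auto simp: D_def)
          then have ex: "\<exists>n. x \<in> D n" by blast
          define n where "n = (LEAST n. x \<in> D n)"
          have n: "x \<in> D n" "\<And>j. j < n \<Longrightarrow> x \<notin> D j"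
            using LeastI_ex[OF ex] not_less_Least by (auto simp: n_def)
          have "k < n"
            using n(1) D_mono[of n k] False by force
          then have "x \<in> R ((n - 1 - k) + k)"
            using n by (auto simp: R_def)
          then show ?thesis by blast
        qed simp
        then have "f (A - F) \<le> f (D k \<union> (\<Union>i. R (i + k)))"
          by (intro mono) blast
        also have "\<dots> \<le> f (D k) + f (\<Union>i. R (i + k))"
          by (rule sub2)
        also have "\<dots> \<le> f (D k) + (\<Sum>i. f (R (i + k)))"
          by (intro add_left_mono csub)
        finally show ?thesis .
      qed
      show ?thesis
      proof (rule ennreal_le_epsilon)
        fix e :: real assume e: "0 < e"
        have "(\<lambda>n. \<Sum>i<n. f (R i)) \<longlonglongrightarrow> (\<Sum>i. f (R i))"
          by (intro summable_LIMSEQ) auto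
        then have "(\<lambda>n. (\<Sum>i. f (R i)) - (\<Sum>i<n. f (R i))) \<longlonglongrightarrow> (\<Sum>i. f (R i)) - (\<Sum>i. f (R i))"
          using T by (intro tendsto_diff_ennreal) auto
        then have "\<forall>\<^sub>F n in sequentially. (\<Sum>i. f (R i)) - (\<Sum>i<n. f (R i)) < ennreal e"
          using e T by (intro order_tendstoD) (auto simp: diff_eq_0_iff_ennreal)
        then obtain k where k: "(\<Sum>i. f (R i)) - (\<Sum>i<k. f (R i)) < ennreal e"
          by (auto simp: eventually_sequentially)
        have fink: "(\<Sum>i<k. f (R i)) < top"
          by (rule le_less_trans[OF sum_le_suminf T]) auto
        have "(\<Sum>i. f (R i)) = (\<Sum>i. f (R (i + k))) + (\<Sum>i<k. f (R i))"
        proof (rule LIMSEQ_unique)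
          have "(\<Sum>i<n + k. f (R i)) = (\<Sum>i<n. f (R (i + k))) + (\<Sum>i<k. f (R i))" for n
            by (induction n) (simp_all add: ac_simps)
          then show "(\<lambda>n. (\<Sum>i<n. f (R (i + k))) + (\<Sum>i<k. f (R i))) \<longlonglongrightarrow> (\<Sum>i. f (R i))"
            using LIMSEQ_ignore_initial_segment[OF summable_LIMSEQ[of "\<lambda>i. f (R i)"], of k] by simp
          show "(\<lambda>n. (\<Sum>i<n. f (R (i + k))) + (\<Sum>i<k. f (R i)))
              \<longlonglongrightarrow> (\<Sum>i. f (R (i + k))) + (\<Sum>i<k. f (R i))"
            by (intro tendsto_add summable_LIMSEQ) auto
        qed
        then have "(\<Sum>i. f (R (i + k))) \<le> ennreal e"
          using k fink ennreal_add_diff_cancel_right[of "\<Sum>i<k. f (R i)" "\<Sum>i. f (R (i + k))"]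
          by (metis less_imp_le infinity_ennreal_def less_irrefl)
        then have "f (A \<inter> F) + f (A - F) \<le> f (A \<inter> F) + (f (D k) + ennreal e)"
          by (intro add_left_mono order_trans[OF tail[of k]]) auto
        also have "\<dots> \<le> f A + ennreal e"
          using base[of k] by (simp add: add.assoc[symmetric] add_right_mono)
        finally show "f (A \<inter> F) + f (A - F) \<le> f A + ennreal e" .
      qed
    qed
    moreover have "f A \<le> f (A \<inter> F) + f (A - F)" for A
      using sub2[of "A \<inter> F" "A - F"] by (simp add: Int_Diff_Un)
    ultimately show ?thesis
      by (simp add: P.lambda_system_eq antisym del: Pow_UNIV)
  qed
  have L: "sigma_algebra UNIV (lambda_system UNIV (Pow UNIV) f)"
    using P.caratheodory_lemma[OF oms]
    by (simp add: measure_space_def)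
  have "sigma_sets UNIV {S :: 'a set. closed S} \<subseteq> lambda_system UNIV (Pow UNIV) f"
    using L closed_in by (intro sigma_algebra.sigma_sets_subset) auto
  then show ?thesis
    by (simp add: borel_eq_closed)
qed

lemma hausdorff_premeasure_le:
  assumes "A \<subseteq> (\<Union>i::nat. C i)" "\<And>i. bounded (C i)" "\<And>i. diameter (C i) \<le> \<delta>"
  shows "hausdorff_premeasure s \<delta> A \<le> (\<Sum>i. hausdorff_gauge s (C i))"
  unfolding hausdorff_premeasure_def using assms by (intro INF_lower) auto

lemma hausdorff_coverE:
  assumes "hausdorff_premeasure s \<delta> A < a"
  obtains C :: "nat \<Rightarrow> 'a::metric_space set" where "A \<subseteq> (\<Union>i. C i)" "\<And>i. bounded (C i)"
    "\<And>i. diameter (C i) \<le> \<delta>" "(\<Sum>i. hausdorff_gauge s (C i)) < a"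
  using assms unfolding hausdorff_premeasure_def INF_less_iff by auto

lemma hausdorff_gauge_empty [simp]: "hausdorff_gauge s {} = 0"
  by (simp add: hausdorff_gauge_def)

lemma hausdorff_premeasure_mono:
  "A \<subseteq> B \<Longrightarrow> hausdorff_premeasure s \<delta> A \<le> hausdorff_premeasure s \<delta> B"
  unfolding hausdorff_premeasure_def by (intro INF_superset_mono) auto

lemma hausdorff_premeasure_antimono:
  "\<delta> \<le> \<epsilon> \<Longrightarrow> hausdorff_premeasure s \<epsilon> A \<le> hausdorff_premeasure s \<delta> A"
  unfolding hausdorff_premeasure_def by (intro INF_superset_mono) (auto intro: order_trans)

lemma hausdorff_premeasure_countable_subadditive:
  fixes A :: "nat \<Rightarrow> 'a::metric_space set"
  shows "hausdorff_premeasure s \<delta> (\<Union>i. A i) \<le> (\<Sum>i. hausdorff_premeasure s \<delta> (A i))"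
proof (rule ennreal_le_epsilon)
  fix e :: real
  assume fin: "(\<Sum>i. hausdorff_premeasure s \<delta> (A i)) < top" and e: "0 < e"
  define p where "p i = hausdorff_premeasure s \<delta> (A i)" for i
  have pfin: "p i < top" for i
    using fin sum_le_suminf[of p "{i}"] unfolding p_def[symmetric] by (simp add: le_less_trans)
  have "p i < p i + ennreal (e * (1/2) ^ Suc i)" for i
    using pfin[of i] e by (cases "p i") (auto simp: ennreal_plus[symmetric] ennreal_less_iff simp del: ennreal_plus)
  then have "\<exists>C :: nat \<Rightarrow> 'a set. A i \<subseteq> (\<Union>j. C j) \<and> (\<forall>j. bounded (C j) \<and> diameter (C j) \<le> \<delta>) \<and>
      (\<Sum>j. hausdorff_gauge s (C j)) < p i + ennreal (e * (1/2) ^ Suc i)" for i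
    unfolding p_def by (metis hausdorff_coverE)
  then obtain C :: "nat \<Rightarrow> nat \<Rightarrow> 'a set" where C: "\<And>i. A i \<subseteq> (\<Union>j. C i j)"
      "\<And>i j. bounded (C i j)" "\<And>i j. diameter (C i j) \<le> \<delta>"
      "\<And>i. (\<Sum>j. hausdorff_gauge s (C i j)) < p i + ennreal (e * (1/2) ^ Suc i)"
    by metis
  have geo: "(\<Sum>i. ennreal (e * (1/2) ^ Suc i)) = ennreal e"
    using e sums_mult[OF power_half_series, of e] by (subst suminf_ennreal_eq[of _ e]) auto
  have "hausdorff_premeasure s \<delta> (\<Union>i. A i)
      \<le> (\<Sum>k. hausdorff_gauge s (C (fst (prod_decode k)) (snd (prod_decode k))))"
  proof (rule hausdorff_premeasure_le)
    show "(\<Union>i. A i) \<subseteq> (\<Union>k. C (fst (prod_decode k)) (snd (prod_decode k)))"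
    proof
      fix x assume "x \<in> (\<Union>i. A i)"
      then obtain i j where "x \<in> C i j" using C(1) by blast
      then show "x \<in> (\<Union>k. C (fst (prod_decode k)) (snd (prod_decode k)))"
        by (auto intro!: exI[of _ "prod_encode (i, j)"])
    qed
  qed (use C in auto)
  also have "\<dots> = (\<Sum>i. \<Sum>j. hausdorff_gauge s (C i j))"
    using suminf_ennreal_2dimen[of "\<lambda>i. \<Sum>j. hausdorff_gauge s (C i j)" "\<lambda>(i, j). hausdorff_gauge s (C i j)"]
    by (simp add: comp_def split_beta)
  also have "\<dots> \<le> (\<Sum>i. p i + ennreal (e * (1/2) ^ Suc i))"
    using C(4) by (intro suminf_le) (auto intro: less_imp_le)
  also have "\<dots> = (\<Sum>i. p i) + ennreal e"
    unfolding geo[symmetric] by (rule suminf_add[symmetric]) auto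
  finally show "hausdorff_premeasure s \<delta> (\<Union>i. A i) \<le> (\<Sum>i. hausdorff_premeasure s \<delta> (A i)) + ennreal e"
    by (simp add: p_def)
qed

lemma hausdorff_premeasure_le_outer: "0 < \<delta> \<Longrightarrow> hausdorff_premeasure s \<delta> A \<le> hausdorff_outer s A"
  unfolding hausdorff_outer_def by (intro SUP_upper) auto

lemma outer_measure_space_hausdorff:
  "outer_measure_space (Pow UNIV) (hausdorff_outer s :: 'a::metric_space set \<Rightarrow> ennreal)"
proof -
  have "hausdorff_premeasure s \<delta> ({} :: 'a set) \<le> 0" if "0 < \<delta>" for \<delta>
    using hausdorff_premeasure_le[of "{} :: 'a set" "\<lambda>_. {}" \<delta> s] that by simp
  then have "hausdorff_outer s ({} :: 'a set) = 0"
    by (auto simp: hausdorff_outer_def intro!: antisym SUP_least)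
  moreover have "hausdorff_outer s A \<le> hausdorff_outer s B" if "A \<subseteq> B" for A B :: "'a set"
    unfolding hausdorff_outer_def using that by (intro SUP_mono) (auto intro: hausdorff_premeasure_mono)
  moreover have "hausdorff_outer s (\<Union>i. A i) \<le> (\<Sum>i. hausdorff_outer s (A i))" for A :: "nat \<Rightarrow> 'a set"
    unfolding hausdorff_outer_def[of s "\<Union>i. A i"]
    by (intro SUP_least order_trans[OF hausdorff_premeasure_countable_subadditive] suminf_le)
       (auto intro: hausdorff_premeasure_le_outer)
  ultimately show ?thesis
    by (auto simp: outer_measure_space_def positive_def increasing_def countably_subadditive_def)
qed

text \<open>
  Additivity on separated sets holds already for the premeasure at every scale below the gap,
  because a covering of the union splits into coverings of the two parts.
\<close>
lemma hausdorff_premeasure_separated: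
  fixes A B :: "'a::metric_space set"
  assumes sep: "\<And>x y. x \<in> A \<Longrightarrow> y \<in> B \<Longrightarrow> d \<le> dist x y" and "\<delta> < d"
  shows "hausdorff_premeasure s \<delta> A + hausdorff_premeasure s \<delta> B \<le> hausdorff_premeasure s \<delta> (A \<union> B)"
  unfolding hausdorff_premeasure_def[of s \<delta> "A \<union> B"]
proof (rule INF_greatest)
  fix C :: "nat \<Rightarrow> 'a set"
  assume "C \<in> {C. A \<union> B \<subseteq> (\<Union>i. C i) \<and> (\<forall>i. bounded (C i) \<and> diameter (C i) \<le> \<delta>)}"
  then have C: "A \<union> B \<subseteq> (\<Union>i. C i)" "\<And>i. bounded (C i)" "\<And>i. diameter (C i) \<le> \<delta>"
    by auto
  have \<delta>: "0 \<le> \<delta>"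
    using C(2,3)[of 0] diameter_ge_0[of "C 0"] by linarith
  \<comment> \<open>A set of diameter less than the gap cannot meet both parts.\<close>
  define CA where "CA i = (if C i \<inter> A = {} then {} else C i)" for i
  define CB where "CB i = (if C i \<inter> A = {} then C i else {})" for i
  have "C i \<inter> B = {}" if "C i \<inter> A \<noteq> {}" for i
  proof (rule ccontr)
    assume "C i \<inter> B \<noteq> {}"
    with that obtain x y where "x \<in> C i" "y \<in> C i" "x \<in> A" "y \<in> B" by blast
    then have "d \<le> dist x y" "dist x y \<le> diameter (C i)"
      using sep C(2) by (auto intro: diameter_bounded_bound)
    then show False using C(3)[of i] \<open>\<delta> < d\<close> by linarith
  qed
  then have "A \<subseteq> (\<Union>i. CA i)" "B \<subseteq> (\<Union>i. CB i)"
    using C(1) by (auto simp: CA_def CB_def) blast+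
  then have "hausdorff_premeasure s \<delta> A + hausdorff_premeasure s \<delta> B
      \<le> (\<Sum>i. hausdorff_gauge s (CA i)) + (\<Sum>i. hausdorff_gauge s (CB i))"
    using C \<delta> by (intro add_mono hausdorff_premeasure_le) (auto simp: CA_def CB_def)
  also have "\<dots> = (\<Sum>i. hausdorff_gauge s (CA i) + hausdorff_gauge s (CB i))"
    by (intro suminf_add) auto
  also have "\<dots> = (\<Sum>i. hausdorff_gauge s (C i))"
    by (intro suminf_cong) (auto simp: CA_def CB_def)
  finally show "hausdorff_premeasure s \<delta> A + hausdorff_premeasure s \<delta> B \<le> (\<Sum>i. hausdorff_gauge s (C i))" .
qed

lemma hausdorff_outer_separated:
  fixes A B :: "'a::metric_space set"
  assumes "0 < d" and sep: "\<And>x y. x \<in> A \<Longrightarrow> y \<in> B \<Longrightarrow> d \<le> dist x y"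
  shows "hausdorff_outer s A + hausdorff_outer s B \<le> hausdorff_outer s (A \<union> B)"
proof -
  have "hausdorff_outer s A + hausdorff_outer s B
      = (SUP \<delta>\<in>{0<..}. hausdorff_premeasure s \<delta> A + hausdorff_premeasure s \<delta> B)"
    unfolding hausdorff_outer_def
  proof (rule SUP_add_directed_ennreal[symmetric])
    fix i j :: real assume "i \<in> {0<..}" "j \<in> {0<..}"
    then show "\<exists>k\<in>{0<..}. hausdorff_premeasure s i A + hausdorff_premeasure s j B
        \<le> hausdorff_premeasure s k A + hausdorff_premeasure s k B"
      by (intro bexI[of _ "min i j"] add_mono hausdorff_premeasure_antimono) auto
  qed
  also have "\<dots> \<le> hausdorff_outer s (A \<union> B)"
  proof (rule SUP_least)
    fix \<delta> :: real assume "\<delta> \<in> {0<..}"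
    define \<epsilon> where "\<epsilon> = min \<delta> (d / 2)"
    have \<epsilon>: "0 < \<epsilon>" "\<epsilon> \<le> \<delta>" "\<epsilon> < d"
      using \<open>\<delta> \<in> {0<..}\<close> \<open>0 < d\<close> by (auto simp: \<epsilon>_def)
    have "hausdorff_premeasure s \<delta> A + hausdorff_premeasure s \<delta> B
        \<le> hausdorff_premeasure s \<epsilon> A + hausdorff_premeasure s \<epsilon> B"
      using \<epsilon> by (intro add_mono hausdorff_premeasure_antimono)
    also have "\<dots> \<le> hausdorff_premeasure s \<epsilon> (A \<union> B)"
      using \<epsilon> sep by (intro hausdorff_premeasure_separated[of A B d]) auto
    also have "\<dots> \<le> hausdorff_outer s (A \<union> B)"
      using \<epsilon> by (intro hausdorff_premeasure_le_outer)
    finally show "hausdorff_premeasure s \<delta> A + hausdorff_premeasure s \<delta> B \<le> hausdorff_outer s (A \<union> B)" .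
  qed
  finally show ?thesis .
qed

lemma space_hausdorff_measure [simp]: "space (hausdorff_measure s) = UNIV"
  by (simp add: hausdorff_measure_def space_measure_of_conv)

lemma sets_hausdorff_measure [simp, measurable_cong]: "sets (hausdorff_measure s) = sets borel"
  using sets.sigma_sets_eq[of borel] by (simp add: hausdorff_measure_def sets_measure_of_conv)

text \<open>
  Since \<open>measure_of\<close> yields the zero measure when its argument is not a measure, this is the fact that
  makes the definition of \<open>hausdorff_measure\<close> meaningful.
\<close>
lemma emeasure_hausdorff_measure:
  fixes A :: "'a::metric_space set"
  assumes A: "A \<in> sets borel"
  shows "emeasure (hausdorff_measure s) A = hausdorff_outer s A"
proof -
  let ?f = "hausdorff_outer s :: 'a set \<Rightarrow> ennreal"
  interpret P: sigma_algebra UNIV "Pow UNIV :: 'a set set"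
    by (rule sigma_algebra_Pow)
  have "measure_space UNIV (lambda_system UNIV (Pow UNIV) ?f) ?f"
    by (intro P.caratheodory_lemma[OF outer_measure_space_hausdorff] refl)
  moreover have "sets borel \<subseteq> lambda_system UNIV (Pow UNIV) ?f"
    by (intro metric_outer_measure_borel outer_measure_space_hausdorff hausdorff_outer_separated)
  ultimately have "positive (sets borel) ?f" "countably_additive (sets borel) ?f"
    unfolding measure_space_def positive_def countably_additive_def by blast+
  then show ?thesis
    using A sets.sigma_algebra_axioms[of "borel :: 'a measure"]
    by (intro emeasure_measure_of_sigma[of UNIV "sets borel" ?f A, folded hausdorff_measure_def]) auto
qed

section \<open>Harmonic and subharmonic functions\<close>

text \<open>
  It is simpler to exhibit a gradient and a Hessian as vector-valued functions than as the bounded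
  linear maps that the definition asks for.
\<close>
lemma harmonic_onI:
  fixes f :: "'a::euclidean_space \<Rightarrow> real" and G :: "'a \<Rightarrow> 'a \<Rightarrow> 'a"
  assumes f: "\<And>x. x \<in> S \<Longrightarrow> (f has_derivative (\<lambda>v. g x \<bullet> v)) (at x)"
    and g: "\<And>x. x \<in> S \<Longrightarrow> (g has_derivative G x) (at x)"
    and cont: "\<And>b. b \<in> Basis \<Longrightarrow> continuous_on S (\<lambda>x. G x b)"
    and trace: "\<And>x. x \<in> S \<Longrightarrow> (\<Sum>b\<in>Basis. G x b \<bullet> b) = 0"
  shows "harmonic_on S f"
  unfolding harmonic_on_def
proof (intro exI conjI ballI)
  define H :: "'a \<Rightarrow> 'a \<Rightarrow>\<^sub>L 'a \<Rightarrow>\<^sub>L real" where "H x = Blinfun (\<lambda>v. blinfun_inner_right (G x v))" for x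
  have H: "blinfun_apply (H x) = (\<lambda>v. blinfun_inner_right (G x v))" if "x \<in> S" for x
    unfolding H_def
    by (intro bounded_linear_Blinfun_apply bounded_linear_compose[OF bounded_linear_blinfun_inner_right]
        has_derivative_bounded_linear[OF g[OF that]])
  show "(f has_derivative blinfun_apply (blinfun_inner_right (g x))) (at x)" if "x \<in> S" for x
    using f[OF that] by (simp add: blinfun_inner_right.rep_eq)
  show "((\<lambda>x. blinfun_inner_right (g x)) has_derivative blinfun_apply (H x)) (at x)" if "x \<in> S" for x
    using bounded_linear.has_derivative[OF bounded_linear_blinfun_inner_right g[OF that]]
    by (simp add: H[OF that])
  show "continuous_on S H"
  proof (rule continuous_on_blinfun_componentwise)
    fix b :: 'a assume "b \<in> Basis"
    then have "continuous_on S (\<lambda>x. blinfun_inner_right (G x b))"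
      by (intro bounded_linear.continuous_on[OF bounded_linear_blinfun_inner_right] cont)
    then show "continuous_on S (\<lambda>x. blinfun_apply (H x) b)"
      by (rule continuous_on_eq) (simp add: H)
  qed
  show "(\<Sum>b\<in>Basis. blinfun_apply (blinfun_apply (H x) b) b) = 0" if "x \<in> S" for x
    using trace[OF that] by (simp add: H[OF that])
qed

lemma harmonic_on_subset: "harmonic_on S f \<Longrightarrow> T \<subseteq> S \<Longrightarrow> harmonic_on T f"
  unfolding harmonic_on_def by (elim ex_forward) (auto intro: continuous_on_subset)

lemma harmonic_on_imp_continuous_on: "harmonic_on S f \<Longrightarrow> continuous_on S f"
  unfolding harmonic_on_def by (auto intro!: continuous_at_imp_continuous_on intro: has_derivative_continuous)

lemma harmonic_on_affine: "harmonic_on S (\<lambda>x. v \<bullet> x + c)"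
  by (rule harmonic_onI[where g="\<lambda>_. v" and G="\<lambda>_ _. 0"]) (auto intro!: derivative_eq_intros)

lemma harmonic_on_add:
  assumes "harmonic_on S f" "harmonic_on S g"
  shows "harmonic_on S (\<lambda>x. f x + g x)"
proof -
  obtain f' f'' where f: "\<forall>x\<in>S. (f has_derivative blinfun_apply (f' x)) (at x)"
    "\<forall>x\<in>S. (f' has_derivative blinfun_apply (f'' x)) (at x)" "continuous_on S f''"
    "\<forall>x\<in>S. (\<Sum>b\<in>Basis. blinfun_apply (blinfun_apply (f'' x) b) b) = 0"
    using assms(1) unfolding harmonic_on_def by blast
  obtain g' g'' where g: "\<forall>x\<in>S. (g has_derivative blinfun_apply (g' x)) (at x)"
    "\<forall>x\<in>S. (g' has_derivative blinfun_apply (g'' x)) (at x)" "continuous_on S g''"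
    "\<forall>x\<in>S. (\<Sum>b\<in>Basis. blinfun_apply (blinfun_apply (g'' x) b) b) = 0"
    using assms(2) unfolding harmonic_on_def by blast
  show ?thesis unfolding harmonic_on_def
    by (intro exI[of _ "\<lambda>x. f' x + g' x"] exI[of _ "\<lambda>x. f'' x + g'' x"])
       (use f g in \<open>auto intro!: derivative_eq_intros continuous_intros
          simp: blinfun.add_left sum.distrib fun_eq_iff\<close>)
qed

lemma harmonic_on_cmult:
  assumes "harmonic_on S f"
  shows "harmonic_on S (\<lambda>x. c * f x)"
proof -
  obtain f' f'' where f: "\<forall>x\<in>S. (f has_derivative blinfun_apply (f' x)) (at x)"
    "\<forall>x\<in>S. (f' has_derivative blinfun_apply (f'' x)) (at x)" "continuous_on S f''"
    "\<forall>x\<in>S. (\<Sum>b\<in>Basis. blinfun_apply (blinfun_apply (f'' x) b) b) = 0"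
    using assms(1) unfolding harmonic_on_def by blast
  have 1: "((\<lambda>x. c * f x) has_derivative blinfun_apply (c *\<^sub>R f' x)) (at x)"
    and 2: "((\<lambda>x. c *\<^sub>R f' x) has_derivative blinfun_apply (c *\<^sub>R f'' x)) (at x)" if "x \<in> S" for x
    using f(1,2) that has_derivative_scaleR_right[of f _ "at x" c] has_derivative_scaleR_right[of f' _ "at x" c]
    by (auto simp: scaleR_blinfun.rep_eq)
  show ?thesis unfolding harmonic_on_def
    by (intro exI[of _ "\<lambda>x. c *\<^sub>R f' x"] exI[of _ "\<lambda>x. c *\<^sub>R f'' x"])
       (use 1 2 f(3,4) in \<open>auto intro!: continuous_intros
          simp: blinfun.scaleR_left sum_distrib_left[symmetric]\<close>)
qed

lemma harmonic_on_diff: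
  "harmonic_on S f \<Longrightarrow> harmonic_on S g \<Longrightarrow> harmonic_on S (\<lambda>x. f x - g x)"
  using harmonic_on_add[of S f "\<lambda>x. (- 1) * g x"] harmonic_on_cmult[of S g "- 1"] by simp

lemma harmonic_on_sum:
  "(\<And>i. i \<in> I \<Longrightarrow> harmonic_on S (f i)) \<Longrightarrow> harmonic_on S (\<lambda>x. \<Sum>i\<in>I. f i x)"
  using harmonic_on_affine[of S 0 0]
  by (induction I rule: infinite_finite_induct) (auto intro: harmonic_on_add)

lemma second_derivative_nonpos_at_local_max:
  fixes \<phi> \<psi> :: "real \<Rightarrow> real"
  assumes "0 < d" and \<phi>: "\<And>t. \<bar>t\<bar> < d \<Longrightarrow> (\<phi> has_real_derivative \<psi> t) (at t)"
    and \<psi>: "(\<psi> has_real_derivative l) (at 0)"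
    and max: "\<And>t. \<bar>t\<bar> < d \<Longrightarrow> \<phi> t \<le> \<phi> 0"
  shows "l \<le> 0"
proof (rule ccontr)
  assume "\<not> l \<le> 0"
  have "\<psi> 0 = 0"
    using \<open>0 < d\<close> \<phi>[of 0] max by (intro DERIV_local_max[of \<phi> "\<psi> 0" 0 d]) auto
  obtain e where e: "0 < e" "\<And>t. 0 < t \<Longrightarrow> t < e \<Longrightarrow> \<psi> 0 < \<psi> t"
    using DERIV_pos_inc_right[OF \<psi>] \<open>\<not> l \<le> 0\<close> by auto
  define t where "t = min d e / 2"
  have t: "0 < t" "t < d" "t < e"
    using \<open>0 < d\<close> \<open>0 < e\<close> by (auto simp: t_def)
  obtain z where z: "0 < z" "z < t" "\<phi> t - \<phi> 0 = (t - 0) * \<psi> z"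
    using MVT2[of 0 t \<phi> \<psi>] t \<phi> by force
  have "0 < \<psi> z" using e(2)[of z] z t \<open>\<psi> 0 = 0\<close> by simp
  then have "\<phi> 0 < \<phi> t" using z(3) t(1) by (smt (verit) mult_pos_pos diff_zero)
  then show False using max[of t] t by simp
qed

text \<open>
  At an interior maximum of \<open>w + \<epsilon> * (norm (x - c))\<^sup>2\<close> all pure second derivatives would be
  nonpositive, whereas their sum is the positive number \<open>2 * \<epsilon> * DIM('a)\<close>.
\<close>
lemma harmonic_on_weak_maximum_principle:
  fixes w :: "'a::euclidean_space \<Rightarrow> real"
  assumes w: "harmonic_on (ball c r) w" "continuous_on (cball c r) w"
    and le: "\<And>y. y \<in> sphere c r \<Longrightarrow> w y \<le> 0" and y: "y \<in> ball c r"
  shows "w y \<le> 0"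
proof (rule ccontr)
  assume "\<not> w y \<le> 0"
  then have wy: "0 < w y" by simp
  have r: "0 < r" using y by (metis ball_eq_empty empty_iff not_le)
  define \<epsilon> where "\<epsilon> = w y / (2 * r\<^sup>2)"
  have \<epsilon>: "0 < \<epsilon>" "\<epsilon> * r\<^sup>2 < w y"
    using wy r by (auto simp: \<epsilon>_def)
  define g where "g x = w x + \<epsilon> * ((x - c) \<bullet> (x - c))" for x
  have "continuous_on (cball c r) g"
    unfolding g_def by (intro continuous_intros w)
  moreover have "cball c r \<noteq> {}" using r by simp
  ultimately obtain p where p: "p \<in> cball c r" "\<And>x. x \<in> cball c r \<Longrightarrow> g x \<le> g p"
    using continuous_attains_sup[OF compact_cball] by metis
  have "g x < g y" if "x \<in> sphere c r" for x
  proof -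
    have "(x - c) \<bullet> (x - c) = r\<^sup>2"
      using that by (simp add: dist_norm norm_minus_commute dot_square_norm)
    then have "g x \<le> \<epsilon> * r\<^sup>2" using le[OF that] by (simp add: g_def)
    also have "\<dots> < w y" by (rule \<epsilon>)
    also have "\<dots> \<le> g y" using \<epsilon> by (simp add: g_def)
    finally show ?thesis .
  qed
  then have pb: "p \<in> ball c r"
    using p y by (metis ball_subset_cball linorder_not_le mem_ball mem_cball mem_sphere order_le_less subsetD)
  obtain w' w'' where w': "\<And>x. x \<in> ball c r \<Longrightarrow> (w has_derivative blinfun_apply (w' x)) (at x)"
    "\<And>x. x \<in> ball c r \<Longrightarrow> (w' has_derivative blinfun_apply (w'' x)) (at x)"
    "\<And>x. x \<in> ball c r \<Longrightarrow> (\<Sum>b\<in>Basis. blinfun_apply (blinfun_apply (w'' x) b) b) = 0"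
    using w(1) unfolding harmonic_on_def by blast
  obtain d where d: "0 < d" "ball p d \<subseteq> ball c r"
    using pb open_ball open_contains_ball by metis
  have "blinfun_apply (blinfun_apply (w'' p) b) b + 2 * \<epsilon> \<le> 0" if b: "b \<in> Basis" for b
  proof (rule second_derivative_nonpos_at_local_max[OF d(1)])
    have nb: "norm b = 1" "b \<bullet> b = 1" using b by auto
    have in_ball: "p + t *\<^sub>R b \<in> ball c r" if "\<bar>t\<bar> < d" for t
    proof -
      have "dist p (p + t *\<^sub>R b) = \<bar>t\<bar>" using nb by (simp add: dist_norm)
      then show ?thesis using d(2) that by (metis mem_ball subsetD)
    qed
    show "((\<lambda>t. g (p + t *\<^sub>R b)) has_real_derivative
        blinfun_apply (w' (p + t *\<^sub>R b)) b + 2 * \<epsilon> * ((p + t *\<^sub>R b - c) \<bullet> b)) (at t)" if "\<bar>t\<bar> < d" for t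
    proof -
      have line: "((\<lambda>t. p + t *\<^sub>R b) has_derivative (\<lambda>h. h *\<^sub>R b)) (at t)"
        by (auto intro!: derivative_eq_intros)
      have "((\<lambda>t. w (p + t *\<^sub>R b)) has_derivative (\<lambda>h. blinfun_apply (w' (p + t *\<^sub>R b)) (h *\<^sub>R b))) (at t)"
        using has_derivative_compose[OF line w'(1)[OF in_ball[OF that]]] .
      then have "((\<lambda>t. w (p + t *\<^sub>R b)) has_real_derivative blinfun_apply (w' (p + t *\<^sub>R b)) b) (at t)"
        by (simp add: has_field_derivative_def blinfun.scaleR_right mult.commute[of _ "blinfun_apply _ _"])
      moreover have "((\<lambda>t. \<epsilon> * ((p + t *\<^sub>R b - c) \<bullet> (p + t *\<^sub>R b - c))) has_real_derivative
          2 * \<epsilon> * ((p + t *\<^sub>R b - c) \<bullet> b)) (at t)"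
        unfolding has_field_derivative_def
        by (auto intro!: derivative_eq_intros simp: fun_eq_iff inner_commute algebra_simps)
      ultimately show ?thesis
        unfolding g_def by (rule DERIV_add)
    qed
    show "((\<lambda>t. blinfun_apply (w' (p + t *\<^sub>R b)) b + 2 * \<epsilon> * ((p + t *\<^sub>R b - c) \<bullet> b)) has_real_derivative
        blinfun_apply (blinfun_apply (w'' p) b) b + 2 * \<epsilon>) (at 0)"
    proof (rule DERIV_add)
      have line: "((\<lambda>t. p + t *\<^sub>R b) has_derivative (\<lambda>h. h *\<^sub>R b)) (at 0)"
        by (auto intro!: derivative_eq_intros)
      have "(w' has_derivative blinfun_apply (w'' p)) (at (p + 0 *\<^sub>R b))"
        using w'(2)[OF pb] by simp
      from has_derivative_compose[OF line this]
      have "((\<lambda>t. w' (p + t *\<^sub>R b)) has_derivative (\<lambda>h. blinfun_apply (w'' p) (h *\<^sub>R b))) (at 0)" .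
      then have "((\<lambda>t. blinfun_apply (w' (p + t *\<^sub>R b)) b) has_derivative
          (\<lambda>h. blinfun_apply (blinfun_apply (w'' p) (h *\<^sub>R b)) b)) (at 0)"
        by (auto intro!: derivative_eq_intros)
      then show "((\<lambda>t. blinfun_apply (w' (p + t *\<^sub>R b)) b) has_real_derivative
          blinfun_apply (blinfun_apply (w'' p) b) b) (at 0)"
        by (simp add: has_field_derivative_def blinfun.scaleR_right blinfun.scaleR_left mult.commute[of _ "blinfun_apply _ _"])
      show "((\<lambda>t. 2 * \<epsilon> * ((p + t *\<^sub>R b - c) \<bullet> b)) has_real_derivative 2 * \<epsilon>) (at 0)"
        unfolding has_field_derivative_def
        by (auto intro!: derivative_eq_intros simp: fun_eq_iff nb)
    qed
    show "g (p + t *\<^sub>R b) \<le> g (p + 0 *\<^sub>R b)" if "\<bar>t\<bar> < d" for t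
      using p(2) in_ball[OF that] by (simp add: less_imp_le)
  qed
  then have "(\<Sum>b\<in>Basis. blinfun_apply (blinfun_apply (w'' p) b) b + 2 * \<epsilon>) \<le> 0"
    by (intro sum_nonpos)
  then have "2 * \<epsilon> * real DIM('a) \<le> 0"
    using w'(3)[OF pb] by (simp add: sum.distrib mult.commute)
  then show False using \<epsilon>(1) by (simp add: mult_le_0_iff)
qed

lemma harmonic_on_imp_subharmonic_on:
  assumes "harmonic_on S h"
  shows "subharmonic_on S h"
  unfolding subharmonic_on_def
proof (intro conjI allI impI ballI)
  show "continuous_on S h" using assms by (rule harmonic_on_imp_continuous_on)
  fix x r k y
  assume *: "0 < r \<and> cball x r \<subseteq> S \<and> harmonic_on (ball x r) k \<and>
      continuous_on (cball x r) k \<and> (\<forall>y\<in>sphere x r. h y \<le> k y)" and y: "y \<in> ball x r"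
  have "ball x r \<subseteq> S" using * ball_subset_cball by blast
  then have "harmonic_on (ball x r) (\<lambda>y. h y - k y)"
    using * assms by (intro harmonic_on_diff) (auto intro: harmonic_on_subset)
  moreover have "continuous_on (cball x r) (\<lambda>y. h y - k y)"
    using * \<open>continuous_on S h\<close> by (intro continuous_on_diff) (auto intro: continuous_on_subset)
  ultimately have "h y - k y \<le> 0"
    by (rule harmonic_on_weak_maximum_principle) (use * y in auto)
  then show "h y \<le> k y" by simp
qed

lemma subharmonic_onD:
  "subharmonic_on S u \<Longrightarrow> 0 < r \<Longrightarrow> cball x r \<subseteq> S \<Longrightarrow> harmonic_on (ball x r) h \<Longrightarrow>
    continuous_on (cball x r) h \<Longrightarrow> (\<And>y. y \<in> sphere x r \<Longrightarrow> u y \<le> h y) \<Longrightarrow> y \<in> ball x r \<Longrightarrow> u y \<le> h y"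
  unfolding subharmonic_on_def by blast

lemma subharmonic_on_max:
  assumes "subharmonic_on S u" "subharmonic_on S v"
  shows "subharmonic_on S (\<lambda>x. max (u x) (v x))"
  unfolding subharmonic_on_def
proof (intro conjI allI impI ballI)
  show "continuous_on S (\<lambda>x. max (u x) (v x))"
    using assms by (intro continuous_on_max) (auto simp: subharmonic_on_def)
  fix x r h y
  assume *: "0 < r \<and> cball x r \<subseteq> S \<and> harmonic_on (ball x r) h \<and>
      continuous_on (cball x r) h \<and> (\<forall>y\<in>sphere x r. max (u y) (v y) \<le> h y)" and y: "y \<in> ball x r"
  have "u y \<le> h y" by (rule subharmonic_onD[OF assms(1)]) (use * y in auto)
  moreover have "v y \<le> h y" by (rule subharmonic_onD[OF assms(2)]) (use * y in auto)
  ultimately show "max (u y) (v y) \<le> h y" by simp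
qed

text \<open>
  Raise \<open>K\<close> until it touches \<open>u\<close> from above. If this happens inside the domain, then subharmonicity is
  violated on a small ball around a contact point, because the raised function can be perturbed by
  an affine function, hence within the harmonic functions, so that it still majorises \<open>u\<close> on the
  sphere but falls below \<open>u\<close> at the centre. The choice of the contact point makes this possible.
\<close>
lemma subharmonic_le_harmonic:
  fixes u K :: "'a::euclidean_space \<Rightarrow> real"
  assumes S: "open S" "bounded S"
    and u: "subharmonic_on S u" "continuous_on (closure S) u"
    and K: "harmonic_on S K" "continuous_on (closure S) K"
    and le: "\<And>x. x \<in> frontier S \<Longrightarrow> u x \<le> K x" and y: "y \<in> closure S"
  shows "u y \<le> K y"
proof (rule ccontr)
  assume "\<not> u y \<le> K y"
  define w where "w x = u x - K x" for x
  have w: "continuous_on (closure S) w"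
    unfolding w_def by (intro continuous_intros u K)
  have comp: "compact (closure S)" using S by simp
  obtain q where q: "q \<in> closure S" "\<And>x. x \<in> closure S \<Longrightarrow> w x \<le> w q"
    using continuous_attains_sup[OF comp _ w] y by (metis empty_iff)
  have wq: "0 < w q" using q(2)[OF y] \<open>\<not> u y \<le> K y\<close> by (simp add: w_def)
  define F where "F = {x \<in> closure S. w x = w q}"
  have F_sub: "F \<subseteq> S"
  proof
    fix x assume x: "x \<in> F"
    then have "x \<notin> frontier S" using le[of x] wq by (auto simp: F_def w_def)
    then show "x \<in> S" using x S by (auto simp: F_def frontier_def interior_open)
  qed
  have "F = closure S \<inter> w -` {w q}" by (auto simp: F_def)
  then have "closed F"
    using continuous_closed_preimage[OF w closed_closure closed_singleton] by simp
  then have "compact F"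
    using comp by (metis Int_absorb1 F_def compact_Int_closed mem_Collect_eq subsetI)
  \<comment> \<open>At a contact point of largest norm the rest of the contact set lies strictly on one side of a
    hyperplane, so that tilting the harmonic majorant by an affine function pushes it below the
    subharmonic function.\<close>
  then obtain x0 where x0: "x0 \<in> F" "\<And>x. x \<in> F \<Longrightarrow> norm x \<le> norm x0"
    using continuous_attains_sup[of F norm] q(1) by (auto simp: F_def intro!: continuous_intros)
  obtain r where r: "0 < r" "cball x0 r \<subseteq> S"
    using x0(1) F_sub S(1) open_contains_cball by (metis subsetD)
  have sph: "sphere x0 r \<subseteq> closure S"
    using r closure_subset sphere_cball by blast
  define l where "l x = (x - x0) \<bullet> x0" for x
  have l_neg: "l x < 0" if "x \<in> F" "x \<in> sphere x0 r" for x
  proof -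
    have "x \<noteq> x0" using that(2) r(1) by auto
    then have "0 < (x - x0) \<bullet> (x - x0)" by simp
    moreover have "x \<bullet> x \<le> x0 \<bullet> x0"
      using x0(2)[OF that(1)] by (simp add: norm_le)
    moreover have "(x - x0) \<bullet> (x - x0) = x \<bullet> x - x0 \<bullet> x0 - 2 * l x"
      by (simp add: l_def inner_diff_left inner_diff_right inner_commute)
    ultimately show ?thesis by linarith
  qed
  have cm: "continuous_on (sphere x0 r) (\<lambda>x. max (w q - w x) (- l x))"
    unfolding l_def by (intro continuous_intros continuous_on_max continuous_on_subset[OF w sph])
  have "sphere x0 r \<noteq> {}"
    using r(1) by simp
  then obtain m where m: "m \<in> sphere x0 r"
     "\<And>x. x \<in> sphere x0 r \<Longrightarrow> max (w q - w m) (- l m) \<le> max (w q - w x) (- l x)"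
    using continuous_attains_inf[OF compact_sphere _ cm] by metis
  \<comment> \<open>On the sphere, wherever \<open>l\<close> exceeds \<open>- 2 * \<tau>\<close>, the gap \<open>w q - w\<close> is at least \<open>2 * \<tau>\<close>.\<close>
  define \<tau> where "\<tau> = max (w q - w m) (- l m) / 2"
  have "0 < \<tau>"
  proof (cases "m \<in> F")
    case True
    then show ?thesis using l_neg[OF True m(1)] by (simp add: \<tau>_def less_max_iff_disj)
  next
    case False
    then have "w m < w q" using m(1) sph q(2)[of m] by (auto simp: F_def)
    then show ?thesis by (simp add: \<tau>_def less_max_iff_disj)
  qed
  \<comment> \<open>This bounds \<open>l + \<tau>\<close> on the sphere.\<close>
  define B where "B = r * norm x0 + \<tau>"
  have B: "0 < B" using r(1) \<open>0 < \<tau>\<close> by (simp add: B_def add_nonneg_pos)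
  define \<eta> where "\<eta> = \<tau> / B"
  have \<eta>: "0 < \<eta>" "\<eta> * B = \<tau>" using B \<open>0 < \<tau>\<close> by (auto simp: \<eta>_def)
  define h where "h x = K x + ((- \<eta>) *\<^sub>R x0 \<bullet> x + (w q + \<eta> * (x0 \<bullet> x0) - \<eta> * \<tau>))" for x
  have h_eq: "h x = K x + w q - \<eta> * (l x + \<tau>)" for x
    by (simp add: h_def l_def inner_diff_left inner_commute algebra_simps)
  have sub: "ball x0 r \<subseteq> S" "cball x0 r \<subseteq> closure S"
    using r(2) ball_subset_cball closure_subset by blast+
  have "harmonic_on (ball x0 r) h"
    unfolding h_def by (intro harmonic_on_add harmonic_on_affine harmonic_on_subset[OF K(1) sub(1)])
  moreover have "continuous_on (cball x0 r) h"
    unfolding h_def by (intro continuous_intros continuous_on_subset[OF K(2) sub(2)])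
  moreover have "u x \<le> h x" if x: "x \<in> sphere x0 r" for x
  proof -
    have mx: "2 * \<tau> \<le> max (w q - w x) (- l x)" using m(2)[OF x] by (simp add: \<tau>_def)
    have wx: "w x \<le> w q" using x sph q(2) by blast
    have "\<eta> * (l x + \<tau>) \<le> w q - w x"
    proof (cases "2 * \<tau> \<le> - l x")
      case True
      then have "\<eta> * (l x + \<tau>) \<le> 0" using \<eta>(1) \<open>0 < \<tau>\<close> by (simp add: mult_le_0_iff)
      then show ?thesis using wx by simp
    next
      case False
      have "l x \<le> norm (x - x0) * norm x0" unfolding l_def by (rule norm_cauchy_schwarz)
      then have "l x + \<tau> \<le> B" using x by (simp add: B_def dist_norm norm_minus_commute)
      then have "\<eta> * (l x + \<tau>) \<le> \<tau>" using \<eta> by (metis less_imp_le mult_left_mono)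
      then show ?thesis using mx False \<open>0 < \<tau>\<close> by (simp add: le_max_iff_disj)
    qed
    then show ?thesis by (simp add: h_eq w_def)
  qed
  ultimately have "u x0 \<le> h x0"
    by (rule subharmonic_onD[OF u(1) r]) (use r in auto)
  moreover have "w x0 = w q" using x0(1) by (simp add: F_def)
  moreover have "0 < \<eta> * \<tau>" using \<eta> \<open>0 < \<tau>\<close> by simp
  moreover have "h x0 = K x0 + w q - \<eta> * \<tau>" by (simp add: h_eq l_def)
  ultimately show False using w_def[of x0] by linarith
qed

section \<open>Poisson kernels of exterior balls\<close>

text \<open>
  With \<open>z = p - a\<close>, the numerator equals \<open>(norm (x - z))\<^sup>2 - (norm a)\<^sup>2\<close>: this is, up to a constant factor,
  the Poisson kernel of the ball with centre \<open>z\<close> whose boundary contains the pole \<open>p\<close>, considered on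
  all of the space.
\<close>
definition poisson_kernel :: "'a::euclidean_space \<Rightarrow> 'a \<Rightarrow> 'a \<Rightarrow> real" where
  "poisson_kernel p a x = ((x - p) \<bullet> (x - p) + 2 * (a \<bullet> (x - p))) / norm (x - p) ^ DIM('a)"

lemma has_derivative_inner_powr:
  fixes p :: "'a::euclidean_space"
  assumes "x \<noteq> p"
  shows "((\<lambda>x. ((x - p) \<bullet> (x - p)) powr c) has_derivative
    (\<lambda>v. 2 * c * ((x - p) \<bullet> (x - p)) powr (c - 1) * ((x - p) \<bullet> v))) (at x)"
proof -
  have "0 < (x - p) \<bullet> (x - p)" using assms by simp
  then have "((\<lambda>z. z powr c) has_real_derivative c * ((x - p) \<bullet> (x - p)) powr (c - 1)) (at ((x - p) \<bullet> (x - p)))"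
    by (rule has_real_derivative_powr)
  moreover have "((\<lambda>x. (x - p) \<bullet> (x - p)) has_derivative (\<lambda>v. 2 * ((x - p) \<bullet> v))) (at x)"
    by (auto intro!: derivative_eq_intros simp: inner_commute)
  ultimately have "((\<lambda>x. ((x - p) \<bullet> (x - p)) powr c) has_derivative
      (\<lambda>v. 2 * ((x - p) \<bullet> v) * (c * ((x - p) \<bullet> (x - p)) powr (c - 1)))) (at x)"
    by (rule DERIV_compose_FDERIV)
  then show ?thesis by (simp add: ac_simps)
qed

lemma harmonic_on_poisson_kernel:
  fixes p a :: "'a::euclidean_space"
  shows "harmonic_on (- {p}) (poisson_kernel p a)"
proof -
  define m where "m = real DIM('a) / 2"
  define Q where "Q x = (x - p) \<bullet> (x - p)" for x
  define N where "N x = Q x + 2 * (a \<bullet> (x - p))" for x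
  have K: "poisson_kernel p a x = N x * Q x powr (- m)" if "x \<noteq> p" for x
  proof -
    have "Q x = norm (x - p) powr 2"
      using that by (simp add: Q_def dot_square_norm powr_realpow)
    then have "Q x powr (- m) = norm (x - p) powr (- real DIM('a))"
      by (simp only: powr_powr) (simp add: m_def)
    also have "\<dots> = 1 / norm (x - p) ^ DIM('a)"
      using that by (simp add: powr_minus powr_realpow divide_inverse)
    finally show ?thesis by (simp add: poisson_kernel_def N_def Q_def)
  qed
  define \<alpha> where "\<alpha> x = 2 * Q x powr (- m)" for x
  define \<alpha>' where "\<alpha>' x v = 2 * (2 * (- m) * Q x powr (- m - 1) * ((x - p) \<bullet> v))" for x v
  define \<beta> where "\<beta> x = 2 * m * (N x * Q x powr (- m - 1))" for x
  define \<beta>' where "\<beta>' x v = 2 * m * (N x * (2 * (- m - 1) * Q x powr (- m - 1 - 1) * ((x - p) \<bullet> v))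
      + 2 * ((x - p + a) \<bullet> v) * Q x powr (- m - 1))" for x v
  define g where "g x = \<alpha> x *\<^sub>R (x - p + a) - \<beta> x *\<^sub>R (x - p)" for x
  define G where "G x v = (\<alpha> x *\<^sub>R v + \<alpha>' x v *\<^sub>R (x - p + a)) - (\<beta> x *\<^sub>R v + \<beta>' x v *\<^sub>R (x - p))" for x v
  have dQ: "((\<lambda>x. Q x powr c) has_derivative (\<lambda>v. 2 * c * Q x powr (c - 1) * ((x - p) \<bullet> v))) (at x)" if "x \<noteq> p" for x c
    unfolding Q_def using that by (rule has_derivative_inner_powr)
  have dN: "(N has_derivative (\<lambda>v. 2 * ((x - p + a) \<bullet> v))) (at x)" for x
    unfolding N_def Q_def
    by (auto intro!: derivative_eq_intros simp: inner_commute inner_add_right algebra_simps)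
  have d\<alpha>: "(\<alpha> has_derivative \<alpha>' x) (at x)" if "x \<noteq> p" for x
    unfolding \<alpha>_def \<alpha>'_def by (intro has_derivative_mult_right dQ that)
  have d\<beta>: "(\<beta> has_derivative \<beta>' x) (at x)" if "x \<noteq> p" for x
    unfolding \<beta>_def \<beta>'_def by (intro has_derivative_mult_right has_derivative_mult dN dQ that)
  show ?thesis
  proof (rule harmonic_onI[where g=g and G=G])
    fix x assume "x \<in> - {p}"
    then have x: "x \<noteq> p" by simp
    have "((\<lambda>x. N x * Q x powr (- m)) has_derivative (\<lambda>v. g x \<bullet> v)) (at x)"
      by (rule has_derivative_eq_rhs[OF has_derivative_mult[OF dN dQ[OF x]]])
         (simp add: g_def \<alpha>_def \<beta>_def fun_eq_iff inner_diff_left)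
    then show "(poisson_kernel p a has_derivative (\<lambda>v. g x \<bullet> v)) (at x)"
      by (rule has_derivative_transform_within_open[where s="- {p}"]) (use x K in auto)
    have shift: "((\<lambda>x. x - p + a) has_derivative (\<lambda>v. v)) (at x)" "((\<lambda>x. x - p) has_derivative (\<lambda>v. v)) (at x)"
      by (auto intro!: derivative_eq_intros)
    show "(g has_derivative G x) (at x)"
      unfolding g_def G_def
      by (intro has_derivative_diff has_derivative_scaleR d\<alpha>[OF x] d\<beta>[OF x] shift)
    have Q: "0 < Q x" using x by (simp add: Q_def)
    define A where "A = Q x powr (- m - 2)"
    have "- m - 2 + 1 = - m - 1" "- m - 1 + 1 = - m" "- m - 1 - 1 = - m - 2" by simp_all
    then have A: "Q x powr (- m - 1) = A * Q x" "Q x powr (- m) = A * Q x * Q x" "Q x powr (- m - 1 - 1) = A"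
      using powr_add[of "Q x" "- m - 2" 1] powr_add[of "Q x" "- m - 1" 1] Q
      by (simp_all only: powr_one A_def less_imp_le)
    define s where "s = a \<bullet> (x - p)"
    define w where "w = x - p"
    define z where "z = x - p + a"
    have Ns: "N x = Q x + 2 * s" by (simp add: N_def s_def)
    have i: "(\<Sum>b\<in>Basis. (w \<bullet> b) * (z \<bullet> b)) = Q x + s" "(\<Sum>b\<in>Basis. (w \<bullet> b) * (w \<bullet> b)) = Q x"
      unfolding euclidean_inner[symmetric]
      by (simp_all add: w_def z_def Q_def s_def inner_add_left inner_add_right inner_commute)
    have "G x b \<bullet> b = (\<alpha> x - \<beta> x) - 8 * m * A * Q x * ((w \<bullet> b) * (z \<bullet> b))
        + 4 * m * (m + 1) * N x * A * ((w \<bullet> b) * (w \<bullet> b))" if "b \<in> Basis" for b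
    proof -
      have "G x b \<bullet> b = \<alpha> x + \<alpha>' x b * (z \<bullet> b) - (\<beta> x + \<beta>' x b * (w \<bullet> b))"
        unfolding G_def z_def[symmetric] unfolding w_def[symmetric]
        using that by (simp add: inner_diff_left inner_add_left)
      also have "\<alpha>' x b = - 4 * m * A * Q x * (w \<bullet> b)"
        unfolding \<alpha>'_def A w_def by simp
      also have "\<beta>' x b = 4 * m * A * Q x * (z \<bullet> b) - 4 * m * (m + 1) * N x * A * (w \<bullet> b)"
        unfolding \<beta>'_def A z_def[symmetric] unfolding w_def[symmetric] by (simp add: algebra_simps)
      finally show ?thesis by (simp add: algebra_simps)
    qed
    then have "(\<Sum>b\<in>Basis. G x b \<bullet> b) = 2 * m * (\<alpha> x - \<beta> x) - 8 * m * A * Q x * (Q x + s)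
        + 4 * m * (m + 1) * N x * A * Q x"
      by (simp add: sum.distrib sum_subtractf sum_distrib_left[symmetric] i m_def)
    also have "\<dots> = 0"
      unfolding \<alpha>_def \<beta>_def A Ns by (simp add: algebra_simps)
    finally show "(\<Sum>b\<in>Basis. G x b \<bullet> b) = 0" .
  next
    fix b :: 'a assume "b \<in> Basis"
    have cQ: "continuous_on (- {p}) (\<lambda>x. Q x powr c)" for c
      unfolding Q_def by (intro continuous_intros) auto
    have cN: "continuous_on (- {p}) N"
      unfolding N_def Q_def by (intro continuous_intros)
    show "continuous_on (- {p}) (\<lambda>x. G x b)"
      unfolding G_def \<alpha>_def \<alpha>'_def \<beta>_def \<beta>'_def
      by (intro continuous_on_diff continuous_on_add continuous_on_scaleR continuous_on_mult
          continuous_on_inner continuous_on_const continuous_on_id cQ cN)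
  qed
qed

text \<open>
  The singularity is integrable since its exponent is one less than the dimension. The integrand is
  dominated by a sum of multiples of indicators of the balls of radius \<open>D / 2 ^ k\<close>, whose integrals
  form a geometric series.
\<close>
lemma nn_integral_inverse_norm_power_cball:
  fixes p :: "'a::euclidean_space"
  assumes D: "0 < D"
  shows "(\<integral>\<^sup>+x. ennreal (1 / norm (x - p) ^ (DIM('a) - 1)) * indicator (cball p D) x \<partial>lborel)
    \<le> ennreal (2 ^ DIM('a) * unit_ball_vol (real DIM('a)) * D)"
proof -
  define s where "s = DIM('a) - 1"
  have s: "DIM('a) = Suc s" using DIM_positive[where 'a='a] by (simp add: s_def)
  define V where "V = unit_ball_vol (real DIM('a))"
  have V: "0 \<le> V" by (simp add: V_def)
  define c where "c k = (2 ^ Suc k / D) ^ s" for k :: nat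
  have "ennreal (1 / norm (x - p) ^ s) * indicator (cball p D) x
      \<le> (\<Sum>k. ennreal (c k) * indicator (cball p (D / 2 ^ k)) x)" for x
  proof (cases "x \<in> cball p D")
    case x: True
    have "\<exists>k. 1 / norm (x - p) ^ s \<le> c k \<and> x \<in> cball p (D / 2 ^ k)"
    proof (cases "x = p")
      case True
      then show ?thesis using D by (intro exI[of _ 0]) (cases s; simp add: c_def)
    next
      case False
      then have n0: "0 < norm (x - p)" by simp
      then obtain j where "(1 / 2) ^ j < norm (x - p) / D"
        using real_arch_pow_inv[of "norm (x - p) / D" "1 / 2"] D by auto
      then have ex: "\<exists>j. D / 2 ^ j < norm (x - p)"
        using D by (auto simp: field_simps power_divide)
      define j where "j = (LEAST j. D / 2 ^ j < norm (x - p))"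
      have j: "D / 2 ^ j < norm (x - p)" using LeastI_ex[OF ex] by (simp add: j_def)
      have "j \<noteq> 0" using j x by (intro notI) (simp add: dist_norm norm_minus_commute)
      then obtain k where k: "j = Suc k" by (cases j) auto
      then have "\<not> D / 2 ^ k < norm (x - p)"
        using not_less_Least[of k "\<lambda>j. D / 2 ^ j < norm (x - p)"] by (simp add: j_def)
      moreover have "1 / norm (x - p) \<le> 2 ^ Suc k / D"
        using j n0 D by (simp add: k field_simps)
      then have "(1 / norm (x - p)) ^ s \<le> c k"
        unfolding c_def by (intro power_mono) auto
      ultimately show ?thesis
        by (auto simp: power_divide dist_norm norm_minus_commute)
    qed
    then obtain k where k: "1 / norm (x - p) ^ s \<le> c k" "x \<in> cball p (D / 2 ^ k)" by blast
    define t where "t k = ennreal (c k) * indicator (cball p (D / 2 ^ k)) x" for k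
    have "ennreal (1 / norm (x - p) ^ s) * indicator (cball p D) x \<le> t k"
      using k x by (simp add: ennreal_leI t_def)
    also have "\<dots> \<le> suminf t"
      using sum_le_suminf[of t "{k}"] by simp
    finally show ?thesis unfolding t_def .
  qed simp
  then have "(\<integral>\<^sup>+x. ennreal (1 / norm (x - p) ^ s) * indicator (cball p D) x \<partial>lborel)
      \<le> (\<integral>\<^sup>+x. (\<Sum>k. ennreal (c k) * indicator (cball p (D / 2 ^ k)) x) \<partial>lborel)"
    by (rule nn_integral_mono)
  also have "\<dots> = (\<Sum>k. \<integral>\<^sup>+x. ennreal (c k) * indicator (cball p (D / 2 ^ k)) x \<partial>lborel)"
    by (rule nn_integral_suminf) (intro borel_measurable_times_ennreal borel_measurable_const borel_measurable_indicator, simp)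
  also have "\<dots> = (\<Sum>k. ennreal (2 ^ s * V * D * (1 / 2) ^ k))"
  proof (rule suminf_cong)
    fix k
    have "(\<integral>\<^sup>+x. ennreal (c k) * indicator (cball p (D / 2 ^ k)) x \<partial>lborel)
        = ennreal (c k) * emeasure lborel (cball p (D / 2 ^ k))"
      by (rule nn_integral_cmult_indicator) simp
    also have "\<dots> = ennreal (c k) * ennreal (V * (D / 2 ^ k) ^ Suc s)"
      using D by (simp add: emeasure_cball V_def s del: power_Suc)
    also have "\<dots> = ennreal (c k * (V * (D / 2 ^ k) ^ Suc s))"
      using D V by (simp add: ennreal_mult c_def del: power_Suc)
    also have "c k * (V * (D / 2 ^ k) ^ Suc s) = V * (D / 2 ^ k) * ((2 ^ Suc k / D) * (D / 2 ^ k)) ^ s"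
      by (simp only: c_def power_mult_distrib power_Suc mult_ac)
    also have "(2 ^ Suc k / D) * (D / 2 ^ k) = 2" using D by simp
    also have "V * (D / 2 ^ k) * 2 ^ s = 2 ^ s * V * D * (1 / 2) ^ k" by (simp add: power_divide)
    finally show "(\<integral>\<^sup>+x. ennreal (c k) * indicator (cball p (D / 2 ^ k)) x \<partial>lborel)
        = ennreal (2 ^ s * V * D * (1 / 2) ^ k)" .
  qed
  also have "\<dots> = ennreal (2 ^ Suc s * V * D)"
  proof (rule suminf_ennreal_eq)
    have "(\<lambda>k. (2 ^ s * V * D) * (1 / 2 :: real) ^ k) sums ((2 ^ s * V * D) * (1 / (1 - 1 / 2)))"
      by (intro sums_mult geometric_sums) simp
    then show "(\<lambda>k. 2 ^ s * V * D * (1 / 2) ^ k) sums (2 ^ Suc s * V * D)" by (simp add: mult_ac)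
  qed (use D V in simp)
  finally show ?thesis by (simp add: s V_def)
qed

lemma set_integrable_continuous_closure:
  fixes f :: "'a::euclidean_space \<Rightarrow> real"
  assumes "bounded S" "S \<in> sets borel" "continuous_on (closure S) f"
  shows "set_integrable lborel S f"
proof (rule set_integrable_subset)
  show "set_integrable lborel (closure S) f"
    using assms unfolding set_integrable_def by (intro borel_integrable_compact) auto
qed (use assms closure_subset in auto)

text \<open>
  The touching point lies on the boundary of the exterior ball, because an interior point of that
  ball has a neighbourhood that misses the open set.
\<close>
lemma exterior_ball_radius:
  assumes "open S" and y: "y \<in> frontier S" and z: "cball z \<delta> \<inter> closure S = {y}"
  shows "dist y z = \<delta>"
proof (rule ccontr)
  assume "dist y z \<noteq> \<delta>"
  moreover have "dist y z \<le> \<delta>" using z by (auto simp: dist_commute)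
  ultimately have e: "0 < \<delta> - dist y z" by simp
  have "y \<in> closure S" "y \<notin> S" using y \<open>open S\<close> by (auto simp: frontier_def interior_open)
  then obtain x where x: "x \<in> S" "dist x y < \<delta> - dist y z"
    using e by (meson closure_approachable)
  then have "dist z x \<le> \<delta>"
    using dist_triangle[of z x y] by (simp add: dist_commute)
  then have "x = y" using z x(1) closure_subset by fastforce
  then show False using \<open>y \<notin> S\<close> x(1) by simp
qed

text \<open>
  The pole is moved into the exterior ball by the distance \<open>\<rho>\<close>. On \<open>closure S\<close> the numerator is then
  at least \<open>\<rho> * \<delta>\<close> and at most a constant times the distance to the pole, which gives the lower bound
  near \<open>y\<close> and the integrability with a bound that depends on neither \<open>y\<close> nor \<open>\<rho>\<close>.
\<close>
lemma exterior_ball_kernel: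
  fixes S :: "'a::euclidean_space set"
  assumes "open S" "bounded S" and D: "\<And>x x'. x \<in> closure S \<Longrightarrow> x' \<in> closure S \<Longrightarrow> dist x x' \<le> D"
    and \<delta>: "0 < \<delta>" and y: "y \<in> closure S" "dist y z = \<delta>"
    and ext: "\<And>x. x \<in> closure S \<Longrightarrow> \<delta> \<le> dist x z" and \<rho>: "0 < \<rho>" "\<rho> \<le> \<delta> / 2"
  obtains K where "harmonic_on S K" "continuous_on (closure S) K"
    "\<And>x. x \<in> closure S \<Longrightarrow> 0 \<le> K x"
    "\<And>x. x \<in> closure S \<Longrightarrow> dist y x < \<rho> \<Longrightarrow> \<delta> / 2 ^ DIM('a) \<le> \<rho> ^ (DIM('a) - 1) * K x"
    "(LINT x:S|lborel. K x) \<le> (D + 3 * \<delta>) * (2 ^ DIM('a) * unit_ball_vol (real DIM('a)) * (D + \<delta>))"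
proof -
  define s where "s = DIM('a) - 1"
  have s: "DIM('a) = Suc s" using DIM_positive[where 'a='a] by (simp add: s_def)
  have D0: "0 \<le> D" using D[OF y(1) y(1)] by simp
  \<comment> \<open>The inner ball has centre \<open>z\<close> and radius \<open>norm a = \<delta> - \<rho>\<close>.\<close>
  define p where "p = y + (\<rho> / \<delta>) *\<^sub>R (z - y)"
  define a where "a = p - z"
  have "a = (1 - \<rho> / \<delta>) *\<^sub>R (y - z)"
    by (simp add: a_def p_def algebra_simps)
  then have na: "norm a = \<delta> - \<rho>"
    using y(2) \<rho> \<delta> by (simp add: dist_norm left_diff_distrib)
  have yp: "dist y p = \<rho>"
    using y(2) \<rho> \<delta> by (simp add: p_def dist_norm norm_minus_commute)
  have px: "\<rho> \<le> dist x p" if "x \<in> closure S" for x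
    using ext[OF that] na dist_triangle[of x z p] by (simp add: a_def dist_norm)
  then have p: "p \<notin> closure S" using \<rho> by force
  have num: "(x - p) \<bullet> (x - p) + 2 * (a \<bullet> (x - p)) = (dist x z)\<^sup>2 - (\<delta> - \<rho>)\<^sup>2" for x
  proof -
    have "(x - p) \<bullet> (x - p) + 2 * (a \<bullet> (x - p)) = (x - p + a) \<bullet> (x - p + a) - a \<bullet> a"
      by (simp add: inner_add_left inner_add_right inner_commute)
    also have "x - p + a = x - z" by (simp add: a_def)
    finally show ?thesis
      by (simp add: dot_square_norm na dist_norm)
  qed
  have num_ge: "\<rho> * \<delta> \<le> (dist x z)\<^sup>2 - (\<delta> - \<rho>)\<^sup>2" if "x \<in> closure S" for x
  proof -
    have "\<delta>\<^sup>2 \<le> (dist x z)\<^sup>2" using ext[OF that] \<delta> by (intro power_mono) auto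
    moreover have "\<rho> * \<rho> \<le> \<rho> * \<delta>" using \<rho> by (intro mult_left_mono) auto
    ultimately show ?thesis by (simp add: power2_eq_square algebra_simps)
  qed
  let ?K = "poisson_kernel p a"
  have pos: "0 \<le> ?K x" if "x \<in> closure S" for x
    unfolding poisson_kernel_def num
  proof (rule divide_nonneg_nonneg)
    show "0 \<le> (dist x z)\<^sup>2 - (\<delta> - \<rho>)\<^sup>2"
      using num_ge[OF that] mult_pos_pos[OF \<rho>(1) \<delta>] by linarith
  qed simp
  have upper: "?K x \<le> (D + 3 * \<delta>) * (1 / norm (x - p) ^ s)" if x: "x \<in> closure S" for x
  proof -
    define w where "w = norm (x - p)"
    have w: "0 < w" unfolding w_def dist_norm[symmetric] using px[OF x] \<rho> by linarith
    have "w \<le> D + \<rho>"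
      using dist_triangle[of x p y] D[OF x y(1)] yp by (simp add: w_def dist_norm)
    have "a \<bullet> (x - p) \<le> (\<delta> - \<rho>) * w"
      using norm_cauchy_schwarz[of a "x - p"] by (simp add: na w_def)
    then have "(x - p) \<bullet> (x - p) + 2 * (a \<bullet> (x - p)) \<le> w * (w + 2 * (\<delta> - \<rho>))"
      by (simp add: dot_square_norm w_def power2_eq_square algebra_simps)
    also have "\<dots> \<le> w * (D + 3 * \<delta>)"
      using w \<open>w \<le> D + \<rho>\<close> \<rho> \<delta> by (intro mult_left_mono) auto
    finally have "?K x \<le> w * (D + 3 * \<delta>) / w ^ Suc s"
      unfolding poisson_kernel_def s w_def[symmetric] using w by (intro divide_right_mono) auto
    also have "\<dots> = (D + 3 * \<delta>) * (1 / w ^ s)" using w by simp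
    finally show ?thesis by (simp add: w_def)
  qed
  have lower: "\<delta> / 2 ^ DIM('a) \<le> \<rho> ^ s * ?K x" if x: "x \<in> closure S" "dist y x < \<rho>" for x
  proof -
    define w where "w = norm (x - p)"
    have w: "0 < w" unfolding w_def dist_norm[symmetric] using px[OF x(1)] \<rho> by linarith
    have "w \<le> 2 * \<rho>"
      using dist_triangle[of x p y] x(2) yp by (simp add: w_def dist_norm norm_minus_commute)
    then have "w ^ Suc s \<le> (2 * \<rho>) ^ Suc s" using w by (intro power_mono) auto
    moreover have "0 < w ^ Suc s" using w by simp
    ultimately have "\<rho> * \<delta> / (2 * \<rho>) ^ Suc s \<le> ((dist x z)\<^sup>2 - (\<delta> - \<rho>)\<^sup>2) / w ^ Suc s"
    proof (intro frac_le)
      show "0 \<le> (dist x z)\<^sup>2 - (\<delta> - \<rho>)\<^sup>2"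
        using num_ge[OF x(1)] mult_pos_pos[OF \<rho>(1) \<delta>] by linarith
    qed (use num_ge[OF x(1)] in auto)
    then have "\<rho> ^ s * (\<rho> * \<delta> / (2 * \<rho>) ^ Suc s) \<le> \<rho> ^ s * ?K x"
      unfolding poisson_kernel_def num s w_def using \<rho> by (intro mult_left_mono) auto
    moreover have "\<rho> ^ s * (\<rho> * \<delta> / (2 * \<rho>) ^ Suc s) = \<delta> / 2 ^ Suc s"
      using \<rho> by (simp add: power_mult_distrib)
    ultimately show ?thesis by (simp add: s)
  qed
  have cont: "continuous_on (closure S) ?K"
    using p by (intro continuous_on_subset[OF harmonic_on_imp_continuous_on[OF harmonic_on_poisson_kernel]]) auto
  have "(LINT x:S|lborel. ?K x) \<le> (D + 3 * \<delta>) * (2 ^ DIM('a) * unit_ball_vol (real DIM('a)) * (D + \<delta>))"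
    unfolding set_lebesgue_integral_def
  proof (rule integral_real_bounded)
    have "(\<integral>\<^sup>+x. ennreal (indicator S x *\<^sub>R ?K x) \<partial>lborel)
        \<le> (\<integral>\<^sup>+x. ennreal (D + 3 * \<delta>) * (ennreal (1 / norm (x - p) ^ (DIM('a) - 1)) * indicator (cball p (D + \<delta>)) x) \<partial>lborel)"
    proof (rule nn_integral_mono)
      fix x
      show "ennreal (indicator S x *\<^sub>R ?K x)
          \<le> ennreal (D + 3 * \<delta>) * (ennreal (1 / norm (x - p) ^ (DIM('a) - 1)) * indicator (cball p (D + \<delta>)) x)"
      proof (cases "x \<in> S")
        case True
        then have x: "x \<in> closure S" using closure_subset by blast
        have "dist x p \<le> D + \<delta>"
          using dist_triangle[of x p y] D[OF x y(1)] yp \<rho> \<delta> by simp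
        moreover have "ennreal (?K x) \<le> ennreal (D + 3 * \<delta>) * ennreal (1 / norm (x - p) ^ s)"
          using upper[OF x] D0 \<delta> by (subst ennreal_mult[symmetric]) (auto intro: ennreal_leI)
        ultimately show ?thesis using True by (simp add: s dist_commute)
      qed simp
    qed
    also have "\<dots> = ennreal (D + 3 * \<delta>) * (\<integral>\<^sup>+x. ennreal (1 / norm (x - p) ^ (DIM('a) - 1)) * indicator (cball p (D + \<delta>)) x \<partial>lborel)"
    proof (rule nn_integral_cmult)
      have "(\<lambda>x :: 'a. ennreal (1 / norm (x - p) ^ (DIM('a) - 1))) \<in> borel_measurable lborel"
        by measurable
      moreover have "(indicator (cball p (D + \<delta>)) :: 'a \<Rightarrow> ennreal) \<in> borel_measurable lborel"
        by (intro borel_measurable_indicator) simp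
      ultimately show "(\<lambda>x. ennreal (1 / norm (x - p) ^ (DIM('a) - 1)) * indicator (cball p (D + \<delta>)) x)
          \<in> borel_measurable lborel"
        by (rule borel_measurable_times_ennreal)
    qed
    also have "\<dots> \<le> ennreal (D + 3 * \<delta>) * ennreal (2 ^ DIM('a) * unit_ball_vol (real DIM('a)) * (D + \<delta>))"
      using D0 \<delta> by (intro mult_left_mono nn_integral_inverse_norm_power_cball) auto
    also have "\<dots> = ennreal ((D + 3 * \<delta>) * (2 ^ DIM('a) * unit_ball_vol (real DIM('a)) * (D + \<delta>)))"
      using D0 \<delta> by (intro ennreal_mult[symmetric]) auto
    finally show "(\<integral>\<^sup>+x. ennreal (indicator S x *\<^sub>R ?K x) \<partial>lborel)
        \<le> ennreal ((D + 3 * \<delta>) * (2 ^ DIM('a) * unit_ball_vol (real DIM('a)) * (D + \<delta>)))" .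
  qed (use D0 \<delta> in auto)
  moreover have "harmonic_on S ?K"
    using p closure_subset[of S] by (intro harmonic_on_subset[OF harmonic_on_poisson_kernel]) auto
  ultimately show ?thesis
    using that pos lower cont unfolding s_def by blast
qed

text \<open>
  The boundary values enter only through finitely many balls: the kernels of their centres, weighted
  by \<open>M i * \<rho> i ^ (DIM('a) - 1)\<close>, add up to a harmonic majorant whose integral is controlled by the
  total weight.
\<close>
lemma subharmonic_integral_le_sum:
  fixes S :: "'a::euclidean_space set"
  assumes S: "open S" "bounded S" and ext: "uniform_exterior_sphere S"
  obtains C \<delta> where "0 < C" "0 < \<delta>"
    "\<And>u (I :: 'i set) y \<rho> M. subharmonic_on S u \<Longrightarrow> continuous_on (closure S) u \<Longrightarrow> finite I \<Longrightarrow>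
      (\<And>i. i \<in> I \<Longrightarrow> y i \<in> frontier S \<and> 0 < \<rho> i \<and> \<rho> i \<le> \<delta> \<and> 0 \<le> M i) \<Longrightarrow>
      (\<And>x. x \<in> frontier S \<Longrightarrow> \<exists>i\<in>I. dist (y i) x < \<rho> i \<and> u x \<le> M i) \<Longrightarrow>
      (LINT x:S|lborel. u x) \<le> C * (\<Sum>i\<in>I. M i * \<rho> i ^ (DIM('a) - 1))"
proof -
  obtain \<delta> where \<delta>: "0 < \<delta>" "\<And>y. y \<in> frontier S \<Longrightarrow> \<exists>z. cball z \<delta> \<inter> closure S = {y}"
    using ext unfolding uniform_exterior_sphere_def by blast
  define D where "D = diameter (closure S)"
  have D: "dist x x' \<le> D" if "x \<in> closure S" "x' \<in> closure S" for x x'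
    unfolding D_def using that S by (intro diameter_bounded_bound) auto
  have D0: "0 \<le> D" unfolding D_def using S by (intro diameter_ge_0) auto
  define B where "B = (D + 3 * \<delta>) * (2 ^ DIM('a) * unit_ball_vol (real DIM('a)) * (D + \<delta>))"
  have B: "0 < B" unfolding B_def using D0 \<delta>(1) by (intro mult_pos_pos) auto
  define c where "c = 2 ^ DIM('a) / \<delta>"
  have c: "0 < c" using \<delta>(1) by (simp add: c_def)
  have SB: "S \<in> sets borel" using S(1) by simp
  show ?thesis
  proof (rule that[of "c * B" "\<delta> / 2"])
    fix u :: "'a \<Rightarrow> real" and I :: "'i set" and y \<rho> M
    assume u: "subharmonic_on S u" "continuous_on (closure S) u" and I: "finite I"
      and *: "\<And>i. i \<in> I \<Longrightarrow> y i \<in> frontier S \<and> 0 < \<rho> i \<and> \<rho> i \<le> \<delta> / 2 \<and> 0 \<le> M i"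
      and cover: "\<And>x. x \<in> frontier S \<Longrightarrow> \<exists>i\<in>I. dist (y i) x < \<rho> i \<and> u x \<le> M i"
    have "\<exists>K. harmonic_on S K \<and> continuous_on (closure S) K \<and> (\<forall>x\<in>closure S. 0 \<le> K x) \<and>
        (\<forall>x\<in>closure S. dist (y i) x < \<rho> i \<longrightarrow> 1 \<le> c * (\<rho> i ^ (DIM('a) - 1) * K x)) \<and>
        (LINT x:S|lborel. K x) \<le> B" if i: "i \<in> I" for i
    proof -
      have yi: "y i \<in> frontier S" "y i \<in> closure S" using *[OF i] by (auto simp: frontier_def)
      obtain z where z: "cball z \<delta> \<inter> closure S = {y i}" using \<delta>(2)[OF yi(1)] by blast
      have r: "dist (y i) z = \<delta>" by (rule exterior_ball_radius[OF S(1) yi(1) z])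
      have "\<delta> \<le> dist x z" if "x \<in> closure S" for x
      proof (rule ccontr)
        assume "\<not> \<delta> \<le> dist x z"
        then have "x \<in> cball z \<delta> \<inter> closure S" using that by (simp add: dist_commute)
        then show False using z r \<open>\<not> \<delta> \<le> dist x z\<close> by simp
      qed
      then obtain K where K: "harmonic_on S K" "continuous_on (closure S) K"
        "\<And>x. x \<in> closure S \<Longrightarrow> 0 \<le> K x"
        "\<And>x. x \<in> closure S \<Longrightarrow> dist (y i) x < \<rho> i \<Longrightarrow> \<delta> / 2 ^ DIM('a) \<le> \<rho> i ^ (DIM('a) - 1) * K x"
        "(LINT x:S|lborel. K x) \<le> B"
        using exterior_ball_kernel[OF S D \<delta>(1) yi(2) r] *[OF i] unfolding B_def by metis
      have "1 \<le> c * (\<rho> i ^ (DIM('a) - 1) * K x)" if "x \<in> closure S" "dist (y i) x < \<rho> i" for x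
        using K(4)[OF that] \<delta>(1) by (simp add: c_def field_simps)
      then show ?thesis using K by blast
    qed
    then have "\<exists>K. \<forall>i\<in>I. harmonic_on S (K i) \<and> continuous_on (closure S) (K i) \<and>
        (\<forall>x\<in>closure S. 0 \<le> K i x) \<and>
        (\<forall>x\<in>closure S. dist (y i) x < \<rho> i \<longrightarrow> 1 \<le> c * (\<rho> i ^ (DIM('a) - 1) * K i x)) \<and>
        (LINT x:S|lborel. K i x) \<le> B"
      by (intro bchoice ballI)
    then obtain K where K: "\<And>i. i \<in> I \<Longrightarrow> harmonic_on S (K i)" "\<And>i. i \<in> I \<Longrightarrow> continuous_on (closure S) (K i)"
        "\<And>i x. i \<in> I \<Longrightarrow> x \<in> closure S \<Longrightarrow> 0 \<le> K i x"
        "\<And>i x. i \<in> I \<Longrightarrow> x \<in> closure S \<Longrightarrow> dist (y i) x < \<rho> i \<Longrightarrow> 1 \<le> c * (\<rho> i ^ (DIM('a) - 1) * K i x)"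
        "\<And>i. i \<in> I \<Longrightarrow> (LINT x:S|lborel. K i x) \<le> B"
      by blast
    define m where "m i = c * (M i * \<rho> i ^ (DIM('a) - 1))" for i
    have m: "0 \<le> m i" if "i \<in> I" for i
      using *[OF that] c by (simp add: m_def)
    define H where "H x = (\<Sum>i\<in>I. m i * K i x)" for x
    have H: "harmonic_on S H" "continuous_on (closure S) H"
      unfolding H_def using K(1,2) by (auto intro!: harmonic_on_sum harmonic_on_cmult continuous_intros)
    have le: "u x \<le> H x" if x: "x \<in> frontier S" for x
    proof -
      obtain i where i: "i \<in> I" "dist (y i) x < \<rho> i" "u x \<le> M i" using cover[OF x] by blast
      have xc: "x \<in> closure S" using x by (simp add: frontier_def)
      have "u x \<le> M i * 1" using i by simp
      also have "\<dots> \<le> M i * (c * (\<rho> i ^ (DIM('a) - 1) * K i x))"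
        using *[OF i(1)] K(4)[OF i(1) xc i(2)] by (intro mult_left_mono) auto
      also have "\<dots> = m i * K i x" by (simp add: m_def ac_simps)
      also have "\<dots> \<le> H x"
        unfolding H_def using I i(1) m K(3)[OF _ xc] by (intro member_le_sum) auto
      finally show ?thesis .
    qed
    have "(LINT x:S|lborel. u x) \<le> (LINT x:S|lborel. H x)"
    proof (rule set_integral_mono)
      fix x assume "x \<in> S"
      then show "u x \<le> H x"
        using closure_subset by (intro subharmonic_le_harmonic[OF S u H le]) auto
    qed (intro set_integrable_continuous_closure S SB u H)+
    also have "\<dots> = (\<Sum>i\<in>I. m i * (LINT x:S|lborel. K i x))"
    proof -
      have "set_integrable lborel S (\<lambda>x. m i * K i x)" if "i \<in> I" for i
        using K(2)[OF that] by (intro set_integrable_continuous_closure S SB continuous_intros)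
      then have "(LINT x:S|lborel. H x) = (\<Sum>i\<in>I. LINT x:S|lborel. m i * K i x)"
        unfolding H_def set_lebesgue_integral_def set_integrable_def scaleR_sum_right
        by (rule Bochner_Integration.integral_sum)
      then show ?thesis by simp
    qed
    also have "\<dots> \<le> (\<Sum>i\<in>I. m i * B)"
      using m K(5) by (intro sum_mono mult_left_mono)
    also have "\<dots> = c * B * (\<Sum>i\<in>I. M i * \<rho> i ^ (DIM('a) - 1))"
      by (simp add: m_def sum_distrib_left sum_distrib_right ac_simps)
    finally show "(LINT x:S|lborel. u x) \<le> c * B * (\<Sum>i\<in>I. M i * \<rho> i ^ (DIM('a) - 1))" .
  qed (use c B \<delta> in auto)
qed

section \<open>Volume integrals are controlled by boundary integrals\<close>

text \<open>
  An almost optimal covering for the Hausdorff measure is turned into one by balls centred in the set.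
  A covering set of diameter \<open>d\<close> lies in the ball of any radius greater than \<open>d\<close> around any of its
  points, and the excess can be
  chosen so small that the sum of the powers of the radii hardly changes.
\<close>
lemma hausdorff_ball_cover:
  fixes A :: "'a::metric_space set"
  assumes fin: "hausdorff_outer s A < \<infinity>" and e: "0 < e" and d: "0 < d"
  obtains y :: "nat \<Rightarrow> 'a" and \<rho> I where "\<And>i. i \<in> I \<Longrightarrow> y i \<in> A \<and> 0 < \<rho> i \<and> \<rho> i \<le> d"
    "A \<subseteq> (\<Union>i\<in>I. ball (y i) (\<rho> i))"
    "\<And>J. finite J \<Longrightarrow> J \<subseteq> I \<Longrightarrow>
      (\<Sum>i\<in>J. \<rho> i ^ s) \<le> 2 ^ s / unit_ball_vol (real s) * enn2real (hausdorff_outer s A) + e"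
proof -
  define V where "V = unit_ball_vol (real s)"
  have V: "0 < V" by (simp add: V_def)
  define h where "h = enn2real (hausdorff_outer s A)"
  have h: "hausdorff_outer s A = ennreal h" "0 \<le> h"
    using fin by (simp_all add: h_def)
  define c where "c = 2 ^ s / V"
  have c: "0 < c" using V by (simp add: c_def)
  have "hausdorff_premeasure s (d / 2) A < ennreal (h + e / (2 * c))"
  proof (rule le_less_trans)
    show "hausdorff_premeasure s (d / 2) A \<le> ennreal h"
      using hausdorff_premeasure_le_outer[of "d / 2" s A] d h by simp
    show "ennreal h < ennreal (h + e / (2 * c))"
      using e c h(2) by (simp add: ennreal_less_iff)
  qed
  then obtain C :: "nat \<Rightarrow> 'a set" where C: "A \<subseteq> (\<Union>i. C i)" "\<And>i. bounded (C i)"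
    "\<And>i. diameter (C i) \<le> d / 2" "(\<Sum>i. hausdorff_gauge s (C i)) < ennreal (h + e / (2 * c))"
    by (rule hausdorff_coverE) (rule that)
  define I where "I = {i. C i \<inter> A \<noteq> {}}"
  define y where "y i = (SOME x. x \<in> C i \<inter> A)" for i
  have y: "y i \<in> C i \<inter> A" if "i \<in> I" for i
    unfolding y_def by (rule someI_ex) (use that in \<open>auto simp: I_def\<close>)
  have "\<exists>t. 0 < t \<and> t \<le> d / 2 \<and> (diameter (C i) + t) ^ s \<le> diameter (C i) ^ s + e / 2 * (1 / 2) ^ Suc i" for i
  proof -
    have "((\<lambda>t. (diameter (C i) + t) ^ s) \<longlongrightarrow> (diameter (C i) + 0) ^ s) (at_right 0)"
      by (intro tendsto_intros)
    then have "\<forall>\<^sub>F t in at_right 0. (diameter (C i) + t) ^ s < diameter (C i) ^ s + e / 2 * (1 / 2) ^ Suc i"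
      using e by (intro order_tendstoD) auto
    moreover have "\<forall>\<^sub>F t in at_right 0. 0 < t \<and> t < d / 2"
      using eventually_at_right_real[of 0 "d / 2"] d by (auto elim: eventually_mono)
    ultimately have "\<forall>\<^sub>F t in at_right 0. 0 < t \<and> t < d / 2 \<and>
        (diameter (C i) + t) ^ s < diameter (C i) ^ s + e / 2 * (1 / 2) ^ Suc i"
      by eventually_elim auto
    then obtain t where "0 < t" "t < d / 2" "(diameter (C i) + t) ^ s < diameter (C i) ^ s + e / 2 * (1 / 2) ^ Suc i"
      by (metis (no_types, lifting) eventually_happens' trivial_limit_at_right_real)
    then show ?thesis by (intro exI[of _ t]) auto
  qed
  then obtain t where t: "\<And>i. 0 < t i" "\<And>i. t i \<le> d / 2"
    "\<And>i. (diameter (C i) + t i) ^ s \<le> diameter (C i) ^ s + e / 2 * (1 / 2) ^ Suc i"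
    by metis
  define \<rho> where "\<rho> i = diameter (C i) + t i" for i
  show ?thesis
  proof (rule that[of I y \<rho>])
    show "y i \<in> A \<and> 0 < \<rho> i \<and> \<rho> i \<le> d" if "i \<in> I" for i
      using y[OF that] t(1)[of i] t(2)[of i] C(3)[of i] diameter_ge_0[OF C(2)[of i]] by (auto simp: \<rho>_def)
    show "A \<subseteq> (\<Union>i\<in>I. ball (y i) (\<rho> i))"
    proof
      fix x assume x: "x \<in> A"
      then obtain i where i: "x \<in> C i" using C(1) by blast
      then have "i \<in> I" using x by (auto simp: I_def)
      moreover have "dist (y i) x \<le> diameter (C i)"
        using y[OF \<open>i \<in> I\<close>] i C(2) by (intro diameter_bounded_bound) auto
      ultimately show "x \<in> (\<Union>i\<in>I. ball (y i) (\<rho> i))"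
        using t(1)[of i] by (intro UN_I[of i]) (auto simp: \<rho>_def)
    qed
    fix J assume J: "finite J" "J \<subseteq> I"
    have nn: "0 \<le> V * (diameter (C i) / 2) ^ s" for i
      using V diameter_ge_0[OF C(2)[of i]] by simp
    have "ennreal (\<Sum>i\<in>J. V * (diameter (C i) / 2) ^ s) = (\<Sum>i\<in>J. ennreal (V * (diameter (C i) / 2) ^ s))"
      using nn by (intro sum_ennreal[symmetric])
    also have "\<dots> = (\<Sum>i\<in>J. hausdorff_gauge s (C i))"
      using J(2) y by (intro sum.cong) (auto simp: hausdorff_gauge_def V_def)
    also have "\<dots> \<le> (\<Sum>i. hausdorff_gauge s (C i))"
      using J by (intro sum_le_suminf) auto
    also have "\<dots> < ennreal (h + e / (2 * c))" by (rule C)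
    finally have "(\<Sum>i\<in>J. V * (diameter (C i) / 2) ^ s) < h + e / (2 * c)"
      using nn by (subst (asm) ennreal_less_iff) (auto intro: sum_nonneg)
    then have "c * (\<Sum>i\<in>J. V * (diameter (C i) / 2) ^ s) \<le> c * (h + e / (2 * c))"
      using c by (intro mult_left_mono) auto
    also have "c * (\<Sum>i\<in>J. V * (diameter (C i) / 2) ^ s) = (\<Sum>i\<in>J. diameter (C i) ^ s)"
      using V by (simp add: c_def sum_distrib_left power_divide)
    also have "c * (h + e / (2 * c)) = c * h + e / 2"
      using c by (simp add: field_simps)
    finally have 1: "(\<Sum>i\<in>J. diameter (C i) ^ s) \<le> c * h + e / 2" .
    have "(\<Sum>i\<in>J. (1 / 2 :: real) ^ Suc i) \<le> 1"
      using sum_le_suminf[OF sums_summable[OF power_half_series] J(1)] sums_unique[OF power_half_series] by simp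
    then have 2: "(\<Sum>i\<in>J. e / 2 * (1 / 2) ^ Suc i) \<le> e / 2"
      using e by (simp only: sum_distrib_left[symmetric]) (simp add: mult_left_le)
    have "(\<Sum>i\<in>J. \<rho> i ^ s) \<le> (\<Sum>i\<in>J. diameter (C i) ^ s + e / 2 * (1 / 2) ^ Suc i)"
      unfolding \<rho>_def by (intro sum_mono t)
    then show "(\<Sum>i\<in>J. \<rho> i ^ s) \<le> 2 ^ s / unit_ball_vol (real s) * enn2real (hausdorff_outer s A) + e"
      using 1 2 by (simp add: sum.distrib c_def V_def h_def)
  qed
qed

lemma integrable_on_compact_finite_measure:
  fixes u :: "'a::metric_space \<Rightarrow> real"
  assumes M: "sets M = sets borel" and F: "compact F" "emeasure M F < \<infinity>" and u: "continuous_on F u"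
  shows "set_integrable M F u"
proof -
  have "F \<in> sets borel" using compact_imp_closed[OF F(1)] by simp
  then have "(\<lambda>x. indicator F x *\<^sub>R u x) \<in> borel_measurable M"
    using borel_measurable_continuous_on_indicator[OF _ u] by (simp cong: measurable_cong_sets add: M)
  moreover obtain B where "\<And>x. x \<in> F \<Longrightarrow> norm (u x) \<le> B"
    using compact_imp_bounded[OF compact_continuous_image[OF u F(1)]] by (auto simp: bounded_iff)
  ultimately show ?thesis
    unfolding set_integrable_def using F(2) \<open>F \<in> sets borel\<close> M
    by (intro integrableI_bounded_set[of F M _ B]) auto
qed

lemma hausdorff_outer_mono: "A \<subseteq> B \<Longrightarrow> hausdorff_outer s A \<le> hausdorff_outer s B"
  unfolding hausdorff_outer_def by (intro SUP_mono) (auto intro: hausdorff_premeasure_mono)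

lemma measure_hausdorff_measure:
  "A \<in> sets borel \<Longrightarrow> measure (hausdorff_measure s) A = enn2real (hausdorff_outer s A)"
  by (simp add: measure_def emeasure_hausdorff_measure)

text \<open>
  A Riemann sum for the surface integral: the set is divided into the level sets on which \<open>u\<close> varies
  by at most \<open>\<eta>\<close>, and each of them is covered separately. Balls that are small with respect to the
  modulus of continuity of \<open>u\<close> carry a bound for \<open>u\<close> that exceeds its value at the centre by at most
  \<open>2 * \<eta>\<close>.
\<close>
lemma compact_cover_by_majorising_balls:
  fixes F :: "'a::metric_space set" and u :: "'a \<Rightarrow> real"
  assumes F: "compact F" and fin: "hausdorff_outer s F < \<infinity>"
    and u: "continuous_on F u" "\<And>x. x \<in> F \<Longrightarrow> 0 \<le> u x" and e: "0 < e" and d: "0 < d"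
  obtains I :: "(nat \<times> nat) set" and y \<rho> M where "finite I"
    "\<And>i. i \<in> I \<Longrightarrow> y i \<in> F \<and> 0 < \<rho> i \<and> \<rho> i \<le> d \<and> 0 \<le> M i"
    "\<And>x. x \<in> F \<Longrightarrow> \<exists>i\<in>I. dist (y i) x < \<rho> i \<and> u x \<le> M i"
    "(\<Sum>i\<in>I. M i * \<rho> i ^ s) \<le> 2 ^ s / unit_ball_vol (real s) * (LINT x:F|hausdorff_measure s. u x) + e"
proof -
  define \<mu> where "\<mu> = (hausdorff_measure s :: 'a measure)"
  have FB: "F \<in> sets \<mu>" "F \<in> sets borel" using compact_imp_closed[OF F] by (auto simp: \<mu>_def)
  have muF: "emeasure \<mu> F < \<infinity>"
    using fin FB by (simp add: \<mu>_def emeasure_hausdorff_measure)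
  define c where "c = 2 ^ s / unit_ball_vol (real s)"
  have c: "0 < c" by (simp add: c_def)
  define h where "h A = measure \<mu> A" for A
  \<comment> \<open>The total error of the construction turns out to be \<open>2 * c * \<eta> * h F + \<eta>\<close>.\<close>
  define \<eta> where "\<eta> = e / (2 * c * h F + 1)"
  have "0 < 2 * c * h F + 1" using c by (intro add_nonneg_pos mult_nonneg_nonneg) (auto simp: h_def)
  then have \<eta>: "0 < \<eta>" "\<eta> * (2 * c * h F + 1) = e" using e by (auto simp: \<eta>_def)
  obtain d1 where d1: "0 < d1" "\<And>x x'. x \<in> F \<Longrightarrow> x' \<in> F \<Longrightarrow> dist x' x < d1 \<Longrightarrow> dist (u x') (u x) < \<eta>"
    using compact_uniformly_continuous[OF u(1) F] \<eta>(1) unfolding uniformly_continuous_on_def by metis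
  obtain B where B: "\<And>x. x \<in> F \<Longrightarrow> norm (u x) \<le> B"
    using compact_imp_bounded[OF compact_continuous_image[OF u(1) F]] by (auto simp: bounded_iff)
  obtain J :: nat where "B / \<eta> < real J" using reals_Archimedean2 by blast
  then have J: "u x < real J * \<eta>" if "x \<in> F" for x
    using B[OF that] u(2)[OF that] \<eta>(1) by (simp add: field_simps)
  define A where "A j = {x \<in> F. real j * \<eta> \<le> u x \<and> u x < (real j + 1) * \<eta>}" for j :: nat
  have AF: "A j \<subseteq> F" for j by (auto simp: A_def)
  have AB: "A j \<in> sets borel" for j
  proof -
    have "closed (F \<inter> u -` {real k * \<eta>..})" for k :: nat
      using u(1) compact_imp_closed[OF F] by (intro continuous_closed_preimage) auto
    then have "(F \<inter> u -` {real j * \<eta>..}) - (F \<inter> u -` {real (Suc j) * \<eta>..}) \<in> sets borel"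
      by (intro sets.Diff borel_closed)
    also have "(F \<inter> u -` {real j * \<eta>..}) - (F \<inter> u -` {real (Suc j) * \<eta>..}) = A j"
      by (auto simp: A_def algebra_simps)
    finally show ?thesis .
  qed
  have A_unique: "i = j" if "x \<in> A i" "x \<in> A j" for x i j
  proof -
    have "real i * \<eta> < (real j + 1) * \<eta>" "real j * \<eta> < (real i + 1) * \<eta>"
      using that by (auto simp: A_def)
    then have "real i < real j + 1" "real j < real i + 1"
      using \<eta>(1) by (simp_all only: mult_less_cancel_right_pos)
    then show ?thesis by linarith
  qed
  have A_cover: "\<exists>j<J. x \<in> A j" if x: "x \<in> F" for x
  proof -
    define j where "j = nat \<lfloor>u x / \<eta>\<rfloor>"
    have "0 \<le> u x / \<eta>" using u(2)[OF x] \<eta>(1) by simp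
    then have "real j \<le> u x / \<eta>" "u x / \<eta> < real j + 1"
      by (auto simp: j_def le_nat_floor)
    then have "real j * \<eta> \<le> u x" "u x < (real j + 1) * \<eta>"
      using \<eta>(1) by (simp_all add: field_simps)
    moreover from this(1) have "real j * \<eta> < real J * \<eta>" using J[OF x] by linarith
    then have "j < J" using \<eta>(1) by (simp add: mult_less_cancel_right_pos)
    ultimately show ?thesis using x by (auto simp: A_def)
  qed
  have level_sum: "(\<Sum>j<J. a j * h (A j)) \<le> (LINT x:F|\<mu>. g x)"
    if "\<And>j x. x \<in> A j \<Longrightarrow> a j \<le> g x" "\<And>x. x \<in> F \<Longrightarrow> 0 \<le> g x" "continuous_on F g"
    for a :: "nat \<Rightarrow> real" and g :: "'a \<Rightarrow> real"
  proof -
    have hA: "emeasure \<mu> (A j) < \<infinity>" for j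
      using emeasure_mono[OF AF FB(1)] muF by (rule le_less_trans)
    have "(\<Sum>j<J. a j * h (A j)) = (LINT x|\<mu>. (\<Sum>j<J. a j * indicator (A j) x))"
      using AB hA by (subst Bochner_Integration.integral_sum) (auto simp: h_def \<mu>_def)
    also have "\<dots> \<le> (LINT x|\<mu>. indicator F x *\<^sub>R g x)"
    proof (rule integral_mono)
      show "integrable \<mu> (\<lambda>x. indicator F x *\<^sub>R g x)"
        using integrable_on_compact_finite_measure[OF _ F muF that(3)]
        by (simp add: \<mu>_def set_integrable_def)
      show "(\<Sum>j<J. a j * indicator (A j) x) \<le> indicator F x *\<^sub>R g x" for x
      proof (cases "x \<in> F")
        case True
        obtain j where j: "j < J" "x \<in> A j" using A_cover[OF True] by blast
        have ind: "a i * indicator (A i) x = (if i = j then a j else 0)" for i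
          using A_unique[of x i j] j(2) by (cases "x \<in> A i") auto
        have "(\<Sum>j<J. a j * indicator (A j) x) = (\<Sum>i<J. if i = j then a j else 0)"
          by (simp only: ind)
        also have "\<dots> = a j" using j(1) by simp
        finally show ?thesis using that(1)[OF j(2)] True by simp
      next
        case False
        then have "x \<notin> A j" for j using AF by blast
        then show ?thesis using False by simp
      qed
      show "integrable \<mu> (\<lambda>x. \<Sum>j<J. a j * indicator (A j) x)"
        using AB hA by (intro Bochner_Integration.integrable_sum integrable_mult_right integrable_real_indicator)
          (auto simp: \<mu>_def)
    qed
    finally show ?thesis by (simp add: set_lebesgue_integral_def)
  qed
  \<comment> \<open>The error allowed on the \<open>j\<close>-th level is chosen such that the errors, weighted by the bounds
    \<open>(j + 2) * \<eta>\<close> for \<open>u\<close>, add up to at most \<open>\<eta>\<close>.\<close>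
  define \<epsilon> where "\<epsilon> j = 1 / ((real j + 2) * (real J + 1))" for j :: nat
  define d' where "d' = min d d1"
  have d': "0 < d'" using d d1 by (simp add: d'_def)
  define Q where "Q j Y R I \<longleftrightarrow>
      (\<forall>i\<in>I. Y i \<in> A j \<and> 0 < R i \<and> R i \<le> d') \<and> A j \<subseteq> (\<Union>i\<in>I. ball (Y i) (R i)) \<and>
      (\<forall>K. finite K \<and> K \<subseteq> I \<longrightarrow> (\<Sum>i\<in>K. R i ^ s) \<le> c * h (A j) + \<epsilon> j)"
    for j and Y :: "nat \<Rightarrow> 'a" and R I
  have "\<exists>Y R I. Q j Y R I" for j
  proof -
    have "hausdorff_outer s (A j) < \<infinity>"
      using hausdorff_outer_mono[OF AF] fin by (rule le_less_trans)
    moreover have "0 < \<epsilon> j" by (simp add: \<epsilon>_def)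
    ultimately obtain Y :: "nat \<Rightarrow> 'a" and R I where "\<And>i. i \<in> I \<Longrightarrow> Y i \<in> A j \<and> 0 < R i \<and> R i \<le> d'"
      "A j \<subseteq> (\<Union>i\<in>I. ball (Y i) (R i))"
      "\<And>K. finite K \<Longrightarrow> K \<subseteq> I \<Longrightarrow>
        (\<Sum>i\<in>K. R i ^ s) \<le> 2 ^ s / unit_ball_vol (real s) * enn2real (hausdorff_outer s (A j)) + \<epsilon> j"
      using d' by (rule hausdorff_ball_cover) (assumption | rule that)+
    then show ?thesis
      by (intro exI[of _ Y] exI[of _ R] exI[of _ I])
         (simp add: Q_def c_def h_def \<mu>_def measure_hausdorff_measure[OF AB])
  qed
  then obtain Y R I where "\<And>j. Q j (Y j) (R j) (I j)"
    by metis
  note YRI = this[unfolded Q_def]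
  have "F \<subseteq> (\<Union>(j, i)\<in>Sigma {..<J} I. ball (Y j i) (R j i))"
  proof
    fix x assume "x \<in> F"
    then obtain j where "j < J" "x \<in> A j" using A_cover by blast
    moreover then obtain i where "i \<in> I j" "x \<in> ball (Y j i) (R j i)" using YRI[of j] by blast
    ultimately show "x \<in> (\<Union>(j, i)\<in>Sigma {..<J} I. ball (Y j i) (R j i))" by blast
  qed
  then obtain T where T: "T \<subseteq> Sigma {..<J} I" "finite T" "F \<subseteq> (\<Union>(j, i)\<in>T. ball (Y j i) (R j i))"
    using compactE_image[OF F, of "Sigma {..<J} I" "\<lambda>(j, i). ball (Y j i) (R j i)"] by auto
  define y where "y = (\<lambda>(j, i). Y j i)"
  define \<rho> where "\<rho> = (\<lambda>(j, i). R j i)"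
  define M where "M = (\<lambda>(j :: nat, i :: nat). (real j + 2) * \<eta>)"
  show ?thesis
  proof (rule that[of T y \<rho> M])
    show "finite T" by (rule T)
    have inT: "Y j i \<in> A j \<and> 0 < R j i \<and> R j i \<le> d'" if "(j, i) \<in> T" for j i
      using YRI[of j] that T(1) by blast
    show "y i \<in> F \<and> 0 < \<rho> i \<and> \<rho> i \<le> d \<and> 0 \<le> M i" if "i \<in> T" for i
      using inT[of "fst i" "snd i"] that AF \<eta>(1)
      by (auto simp: y_def \<rho>_def M_def d'_def split_beta)
    show "\<exists>i\<in>T. dist (y i) x < \<rho> i \<and> u x \<le> M i" if x: "x \<in> F" for x
    proof -
      obtain j i where ji: "(j, i) \<in> T" "dist (Y j i) x < R j i" using x T(3) by auto
      have Yj: "Y j i \<in> A j" "R j i \<le> d1" using inT[OF ji(1)] by (auto simp: d'_def)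
      have "dist (u x) (u (Y j i)) < \<eta>"
        using ji(2) Yj AF x by (intro d1(2)) (auto simp: dist_commute)
      then have "u x < (real j + 2) * \<eta>"
        using Yj(1) by (auto simp: A_def dist_real_def algebra_simps)
      then show ?thesis using ji by (intro bexI[of _ "(j, i)"]) (auto simp: y_def \<rho>_def M_def)
    qed
    define Tj where "Tj j = {i. (j, i) \<in> T}" for j
    have Tj: "finite (Tj j)" "Tj j \<subseteq> I j" for j
      using finite_imageI[OF T(2), of snd] T(1) by (auto simp: Tj_def elim!: finite_subset[rotated] intro: rev_image_eqI)
    have T_eq: "T = Sigma {..<J} Tj" using T(1) by (auto simp: Tj_def)
    have "(\<Sum>i\<in>T. M i * \<rho> i ^ s) = (\<Sum>j<J. \<Sum>i\<in>Tj j. (real j + 2) * \<eta> * R j i ^ s)"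
      unfolding T_eq M_def \<rho>_def using Tj(1) by (subst sum.Sigma) (auto simp: split_beta)
    also have "\<dots> = (\<Sum>j<J. (real j + 2) * \<eta> * (\<Sum>i\<in>Tj j. R j i ^ s))"
      by (simp add: sum_distrib_left)
    also have "\<dots> \<le> (\<Sum>j<J. (real j + 2) * \<eta> * (c * h (A j) + \<epsilon> j))"
      using YRI Tj \<eta>(1) by (intro sum_mono mult_left_mono) auto
    also have "\<dots> = (\<Sum>j<J. c * (real j * \<eta> * h (A j)) + 2 * c * \<eta> * (1 * h (A j)) + \<eta> / (real J + 1))"
    proof (rule sum.cong)
      fix j
      have "(real j + 2) * \<epsilon> j = 1 / (real J + 1)" by (simp add: \<epsilon>_def)
      then have "(real j + 2) * \<eta> * \<epsilon> j = \<eta> / (real J + 1)" by (metis mult.assoc mult.commute times_divide_eq_right mult_1_right)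
      then show "(real j + 2) * \<eta> * (c * h (A j) + \<epsilon> j)
          = c * (real j * \<eta> * h (A j)) + 2 * c * \<eta> * (1 * h (A j)) + \<eta> / (real J + 1)"
        by (simp add: algebra_simps)
    qed simp
    also have "\<dots> = c * (\<Sum>j<J. real j * \<eta> * h (A j)) + 2 * c * \<eta> * (\<Sum>j<J. 1 * h (A j)) + real J * (\<eta> / (real J + 1))"
      by (simp add: sum.distrib sum_distrib_left)
    also have "\<dots> \<le> c * (LINT x:F|\<mu>. u x) + 2 * c * \<eta> * (LINT x:F|\<mu>. 1) + \<eta>"
    proof (intro add_mono mult_left_mono level_sum)
      show "real J * (\<eta> / (real J + 1)) \<le> \<eta>" using \<eta>(1) by (simp add: field_simps)
    qed (use c \<eta>(1) u in \<open>auto simp: A_def\<close>)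
    also have "(LINT x:F|\<mu>. 1) = h F"
      using FB muF by (simp add: set_lebesgue_integral_def h_def)
    also have "c * (LINT x:F|\<mu>. u x) + 2 * c * \<eta> * h F + \<eta> = c * (LINT x:F|\<mu>. u x) + e"
      using \<eta>(2) by (simp add: algebra_simps)
    finally show "(\<Sum>i\<in>T. M i * \<rho> i ^ s) \<le> 2 ^ s / unit_ball_vol (real s) * (LINT x:F|hausdorff_measure s. u x) + e"
      by (simp add: c_def \<mu>_def)
  qed
qed

lemma subharmonic_volume_le_surface:
  fixes S :: "'a::euclidean_space set"
  assumes S: "open S" "bounded S" and ext: "uniform_exterior_sphere S"
    and fin: "hausdorff_outer (DIM('a) - 1) (frontier S) < \<infinity>"
  obtains C where "0 < C"
    "\<And>u. subharmonic_on S u \<Longrightarrow> continuous_on (closure S) u \<Longrightarrow> (\<And>x. x \<in> S \<Longrightarrow> 0 \<le> u x) \<Longrightarrow>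
      (LINT x:S|lborel. u x) \<le> C * (LINT x:frontier S|surface_measure. u x)"
proof -
  obtain C \<delta> where C: "0 < C" "0 < \<delta>"
    "\<And>u (I :: (nat \<times> nat) set) y \<rho> M. subharmonic_on S u \<Longrightarrow> continuous_on (closure S) u \<Longrightarrow> finite I \<Longrightarrow>
      (\<And>i. i \<in> I \<Longrightarrow> y i \<in> frontier S \<and> 0 < \<rho> i \<and> \<rho> i \<le> \<delta> \<and> 0 \<le> M i) \<Longrightarrow>
      (\<And>x. x \<in> frontier S \<Longrightarrow> \<exists>i\<in>I. dist (y i) x < \<rho> i \<and> u x \<le> M i) \<Longrightarrow>
      (LINT x:S|lborel. u x) \<le> C * (\<Sum>i\<in>I. M i * \<rho> i ^ (DIM('a) - 1))"
    by (rule subharmonic_integral_le_sum[OF S ext, where 'i="nat \<times> nat"]) blast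
  define c where "c = 2 ^ (DIM('a) - 1) / unit_ball_vol (real (DIM('a) - 1))"
  show ?thesis
  proof (rule that[of "C * c"])
    show "0 < C * c" using C(1) by (simp add: c_def)
    fix u :: "'a \<Rightarrow> real"
    assume u: "subharmonic_on S u" "continuous_on (closure S) u" "\<And>x. x \<in> S \<Longrightarrow> 0 \<le> u x"
    have fr: "frontier S \<subseteq> closure S" by (simp add: frontier_def)
    have u0: "0 \<le> u x" if "x \<in> frontier S" for x
      using continuous_ge_on_closure[OF u(2)] u(3) that fr by blast
    have "(LINT x:S|lborel. u x) \<le> C * c * (LINT x:frontier S|surface_measure. u x) + e" if e: "0 < e" for e
    proof -
      have "0 < e / C" using e C(1) by simp
      with compact_frontier_bounded[OF S(2)] fin continuous_on_subset[OF u(2) fr] u0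
      obtain I :: "(nat \<times> nat) set" and y \<rho> M where *: "finite I"
        "\<And>i. i \<in> I \<Longrightarrow> y i \<in> frontier S \<and> 0 < \<rho> i \<and> \<rho> i \<le> \<delta> \<and> 0 \<le> M i"
        "\<And>x. x \<in> frontier S \<Longrightarrow> \<exists>i\<in>I. dist (y i) x < \<rho> i \<and> u x \<le> M i"
        "(\<Sum>i\<in>I. M i * \<rho> i ^ (DIM('a) - 1)) 
            \<le> 2 ^ (DIM('a) - 1) / unit_ball_vol (real (DIM('a) - 1))
              * (LINT x:frontier S|hausdorff_measure (DIM('a) - 1). u x) + e / C"
        using C(2) by (rule compact_cover_by_majorising_balls) (assumption | rule that)+
      have "(LINT x:S|lborel. u x) \<le> C * (\<Sum>i\<in>I. M i * \<rho> i ^ (DIM('a) - 1))"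
        by (rule C(3)[OF u(1,2) *(1-3)])
      also have "\<dots> \<le> C * (c * (LINT x:frontier S|hausdorff_measure (DIM('a) - 1). u x) + e / C)"
        using *(4) C(1) unfolding c_def by (intro mult_left_mono) auto
      also have "\<dots> = C * c * (LINT x:frontier S|surface_measure. u x) + e"
        using C(1) by (simp add: surface_measure_def algebra_simps)
      finally show ?thesis .
    qed
    then show "(LINT x:S|lborel. u x) \<le> C * c * (LINT x:frontier S|surface_measure. u x)"
      by (rule field_le_epsilon)
  qed
qed

section \<open>Finiteness of the surface measure\<close>

text \<open>
  Take \<open>d = x - y\<close> for two boundary points \<open>x\<close> and \<open>y\<close> with exterior normals \<open>v\<close> and \<open>w\<close>. That each
  point lies outside the exterior ball of the other one bounds the angles between \<open>d\<close> and the normals,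
  so that moving both points by \<open>t \<le> \<delta> / 2\<close> along their normals at most halves their distance.
\<close>
lemma exterior_normal_expansion:
  fixes d v w :: "'a::real_inner"
  assumes "0 < \<delta>" "0 \<le> t" "2 * t \<le> \<delta>" and v: "norm v = 1" "\<delta> \<le> norm (d + \<delta> *\<^sub>R v)"
    and w: "norm w = 1" "\<delta> \<le> norm (d - \<delta> *\<^sub>R w)"
  shows "norm d \<le> 2 * norm (d + t *\<^sub>R (v - w))"
proof (cases "d = 0")
  case False
  then have d: "0 < norm d" by simp
  have vv: "v \<bullet> v = 1" "w \<bullet> w = 1" using v(1) w(1) by (simp_all add: norm_eq_1)
  have "\<delta>\<^sup>2 \<le> (norm (d + \<delta> *\<^sub>R v))\<^sup>2" "\<delta>\<^sup>2 \<le> (norm (d - \<delta> *\<^sub>R w))\<^sup>2"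
    using v(2) w(2) \<open>0 < \<delta>\<close> by (auto intro!: power_mono)
  then have "\<delta>\<^sup>2 \<le> d \<bullet> d + 2 * \<delta> * (v \<bullet> d) + \<delta>\<^sup>2" "\<delta>\<^sup>2 \<le> d \<bullet> d - 2 * \<delta> * (w \<bullet> d) + \<delta>\<^sup>2"
    unfolding power2_norm_eq_inner
    by (simp_all add: inner_add_left inner_add_right inner_diff_left inner_diff_right
        inner_commute vv power2_eq_square)
  then have "- (d \<bullet> d) \<le> \<delta> * ((v - w) \<bullet> d)"
    by (simp add: inner_diff_left algebra_simps)
  then have "t * - (d \<bullet> d) \<le> t * (\<delta> * ((v - w) \<bullet> d))"
    using \<open>0 \<le> t\<close> by (rule mult_left_mono)
  moreover have "2 * t * (d \<bullet> d) \<le> \<delta> * (d \<bullet> d)"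
    using \<open>2 * t \<le> \<delta>\<close> by (intro mult_right_mono) auto
  ultimately have "\<delta> * - (d \<bullet> d) \<le> \<delta> * (2 * t * ((v - w) \<bullet> d))"
    by (simp add: algebra_simps)
  then have "- (d \<bullet> d) \<le> 2 * t * ((v - w) \<bullet> d)"
    using \<open>0 < \<delta>\<close> by (simp only: mult_le_cancel_left_pos)
  then have "d \<bullet> d \<le> 2 * ((d + t *\<^sub>R (v - w)) \<bullet> d)"
    by (simp add: inner_add_left)
  also have "(d + t *\<^sub>R (v - w)) \<bullet> d \<le> norm (d + t *\<^sub>R (v - w)) * norm d"
    by (rule norm_cauchy_schwarz)
  finally have "norm d * norm d \<le> (2 * norm (d + t *\<^sub>R (v - w))) * norm d"
    by (simp add: dot_square_norm power2_eq_square)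
  then show ?thesis using d by (simp add: mult_le_cancel_right)
qed simp

text \<open>
  Each of the \<open>N\<close> separated points is moved along its exterior normal by all multiples of \<open>r\<close> up to
  \<open>\<delta> / 2\<close>. Points on the same level stay separated by the expansion bound, and points on different
  levels have different distances to \<open>closure S\<close>. The balls of radius \<open>r / 4\<close> around these roughly
  \<open>N * \<delta> / r\<close> points are thus disjoint, and comparing volumes shows that \<open>N\<close> is at most a constant times \<open>r powr (1 - n)\<close>.
\<close>
lemma frontier_packing_bound:
  fixes S :: "'a::euclidean_space set"
  assumes S: "open S" "bounded S" and \<delta>: "0 < \<delta>"
    and ext: "\<And>y. y \<in> frontier S \<Longrightarrow> \<exists>z. cball z \<delta> \<inter> closure S = {y}"
  obtains B where "\<And>F r. finite F \<Longrightarrow> F \<subseteq> frontier S \<Longrightarrow> 0 < r \<Longrightarrow> 4 * r \<le> \<delta> \<Longrightarrow>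
    (\<And>x y. x \<in> F \<Longrightarrow> y \<in> F \<Longrightarrow> x \<noteq> y \<Longrightarrow> r \<le> dist x y) \<Longrightarrow> real (card F) * r ^ (DIM('a) - 1) \<le> B"
proof -
  define s where "s = DIM('a) - 1"
  have s: "DIM('a) = Suc s" using DIM_positive[where 'a='a] by (simp add: s_def)
  define V where "V = unit_ball_vol (real DIM('a))"
  have V: "0 < V" by (simp add: V_def)
  obtain z where z: "\<And>y. y \<in> frontier S \<Longrightarrow> cball (z y) \<delta> \<inter> closure S = {y}"
    using ext by metis
  have fc: "y \<in> closure S" if "y \<in> frontier S" for y using that by (simp add: frontier_def)
  have zr: "dist y (z y) = \<delta>" if "y \<in> frontier S" for y
    by (rule exterior_ball_radius[OF S(1) that z[OF that]])
  have zd: "\<delta> \<le> dist x (z y)" if "y \<in> frontier S" "x \<in> closure S" for x y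
  proof (rule ccontr)
    assume less: "\<not> \<delta> \<le> dist x (z y)"
    then have "x \<in> cball (z y) \<delta> \<inter> closure S" using that by (simp add: dist_commute)
    then show False using z[OF that(1)] zr[OF that(1)] less by simp
  qed
  define \<nu> where "\<nu> y = (1 / \<delta>) *\<^sub>R (z y - y)" for y
  have \<nu>: "norm (\<nu> y) = 1" "z y = y + \<delta> *\<^sub>R \<nu> y" if "y \<in> frontier S" for y
    using zr[OF that] \<delta> by (auto simp: \<nu>_def dist_norm norm_minus_commute)
  obtain R where R: "\<And>x. x \<in> closure S \<Longrightarrow> norm x \<le> R" "0 < R"
    using S(2) bounded_closure bounded_pos by metis
  have far: "t \<le> dist (y + t *\<^sub>R \<nu> y) x" if y: "y \<in> frontier S" and x: "x \<in> closure S" and t: "0 \<le> t" "t \<le> \<delta>" for x y t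
  proof -
    have "z y - (y + t *\<^sub>R \<nu> y) = (\<delta> - t) *\<^sub>R \<nu> y"
      using \<nu>(2)[OF y] by (simp add: algebra_simps)
    then have "dist (z y) (y + t *\<^sub>R \<nu> y) = \<delta> - t"
      using t \<nu>(1)[OF y] by (simp add: dist_norm)
    then show ?thesis
      using zd[OF y x] dist_triangle[of x "z y" "y + t *\<^sub>R \<nu> y"] by (simp add: dist_commute)
  qed
  show ?thesis
  proof (rule that)
    fix F :: "'a set" and r :: real
    assume F: "finite F" "F \<subseteq> frontier S" and r: "0 < r" "4 * r \<le> \<delta>"
      and sep: "\<And>x y. x \<in> F \<Longrightarrow> y \<in> F \<Longrightarrow> x \<noteq> y \<Longrightarrow> r \<le> dist x y"
    define K where "K = nat \<lfloor>\<delta> / (2 * r)\<rfloor>"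
    have K: "\<delta> / (4 * r) \<le> real K" "real K \<le> \<delta> / (2 * r)"
    proof -
      have "1 \<le> \<delta> / (4 * r)" using r by (simp add: field_simps)
      moreover have "\<delta> / (2 * r) < real K + 1" "real K \<le> \<delta> / (2 * r)"
        using r \<delta> by (auto simp: K_def)
      moreover have "\<delta> / (2 * r) = 2 * (\<delta> / (4 * r))" using r by simp
      ultimately show "\<delta> / (4 * r) \<le> real K" "real K \<le> \<delta> / (2 * r)" by linarith+
    qed
    define P where "P = (\<lambda>(y, k :: nat). y + (real k * r) *\<^sub>R \<nu> y)"
    have kr: "0 \<le> real k * r" "2 * (real k * r) \<le> \<delta>" if "k < K" for k
    proof -
      have "real k \<le> \<delta> / (2 * r)" using that K(2) by linarith
      then show "2 * (real k * r) \<le> \<delta>" using r(1) by (simp add: field_simps)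
    qed (use r in simp)
    have level: "r \<le> dist (P (y, k)) (P (x, l))"
      if "x \<in> F" "y \<in> F" "l < k" "k < K" for x y k l
    proof -
      have fr: "x \<in> frontier S" "y \<in> frontier S" using that F(2) by auto
      have "real k * r \<le> dist (P (y, k)) x"
        using far[OF fr(2) fc[OF fr(1)], of "real k * r"] kr[of k] that by (simp add: P_def)
      moreover have "dist (P (x, l)) x = real l * r"
        using \<nu>(1)[OF fr(1)] r by (simp add: P_def dist_norm)
      moreover have "(real l + 1) * r \<le> real k * r"
        using that r by (intro mult_right_mono) auto
      ultimately show ?thesis
        using dist_triangle[of "P (y, k)" x "P (x, l)"] by (simp add: algebra_simps)
    qed
    have P_sep: "r / 2 \<le> dist (P i) (P j)" if ij: "i \<in> F \<times> {..<K}" "j \<in> F \<times> {..<K}" "i \<noteq> j" for i j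
    proof -
      obtain x k y l where i: "i = (x, k)" "x \<in> F" "k < K" and j: "j = (y, l)" "y \<in> F" "l < K"
        using ij by auto
      consider "k < l" | "l < k" | "k = l" by linarith
      then show ?thesis
      proof cases
        case 1
        then show ?thesis using level[of x y k l] i j r by (simp add: dist_commute)
      next
        case 2
        then show ?thesis using level[of y x l k] i j r by simp
      next
        case 3
        have fr: "x \<in> frontier S" "y \<in> frontier S" using i j F(2) by auto
        have "dist x y \<le> 2 * norm ((x - y) + (real k * r) *\<^sub>R (\<nu> x - \<nu> y))"
          unfolding dist_norm
        proof (rule exterior_normal_expansion[OF \<delta> kr[OF i(3)] \<nu>(1)[OF fr(1)] _ \<nu>(1)[OF fr(2)]])
          show "\<delta> \<le> norm (x - y + \<delta> *\<^sub>R \<nu> x)"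
            using zd[OF fr(1) fc[OF fr(2)]] \<nu>(2)[OF fr(1)] by (simp add: dist_norm norm_minus_commute algebra_simps)
          show "\<delta> \<le> norm (x - y - \<delta> *\<^sub>R \<nu> y)"
            using zd[OF fr(2) fc[OF fr(1)]] \<nu>(2)[OF fr(2)] by (simp add: dist_norm algebra_simps)
        qed
        also have "(x - y) + (real k * r) *\<^sub>R (\<nu> x - \<nu> y) = P i - P j"
          using 3 i j by (simp add: P_def algebra_simps)
        finally have "dist x y \<le> 2 * dist (P i) (P j)" by (simp add: dist_norm)
        moreover have "r \<le> dist x y" using sep[OF i(2) j(2)] i j ij(3) 3 by auto
        ultimately show ?thesis by simp
      qed
    qed
    have disj: "disjoint_family_on (\<lambda>i. ball (P i) (r / 4)) (F \<times> {..<K})"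
      unfolding disjoint_family_on_def
    proof (intro ballI impI)
      fix i j assume ij: "i \<in> F \<times> {..<K}" "j \<in> F \<times> {..<K}" "i \<noteq> j"
      show "ball (P i) (r / 4) \<inter> ball (P j) (r / 4) = {}"
      proof (rule ccontr)
        assume "ball (P i) (r / 4) \<inter> ball (P j) (r / 4) \<noteq> {}"
        then obtain x where "dist (P i) x < r / 4" "dist (P j) x < r / 4" by auto
        then show False using P_sep[OF ij] dist_triangle2[of "P i" "P j" x] by linarith
      qed
    qed
    have "emeasure lborel (ball c e :: 'a set) \<noteq> \<infinity>" for c e
      using emeasure_bounded_finite[OF bounded_ball, of c e] by simp
    then have "(\<Sum>i\<in>F \<times> {..<K}. measure lborel (ball (P i) (r / 4))) = measure lborel (\<Union>i\<in>F \<times> {..<K}. ball (P i) (r / 4))"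
      using disj F(1) by (intro measure_finite_Union[symmetric]) auto
    also have "\<dots> \<le> measure lborel (cball 0 (R + \<delta>) :: 'a set)"
    proof (rule measure_mono_fmeasurable)
      show "(\<Union>i\<in>F \<times> {..<K}. ball (P i) (r / 4)) \<subseteq> cball 0 (R + \<delta>)"
      proof clarsimp
        fix x y k assume yk: "y \<in> F" "k < K" and "dist (P (y, k)) x * 4 < r"
        have fr: "y \<in> frontier S" using yk F(2) by auto
        have "norm (P (y, k)) \<le> norm y + real k * r"
          using norm_triangle_ineq[of y "(real k * r) *\<^sub>R \<nu> y"] \<nu>(1)[OF fr] r by (simp add: P_def)
        moreover have "norm x \<le> norm (P (y, k)) + dist (P (y, k)) x"
          by (metis dist_commute dist_norm norm_triangle_sub)
        ultimately show "norm x \<le> R + \<delta>"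
          using R(1)[OF fc[OF fr]] kr[OF yk(2)] r \<open>dist (P (y, k)) x * 4 < r\<close> by linarith
      qed
      show "(\<Union>i\<in>F \<times> {..<K}. ball (P i) (r / 4)) \<in> sets lborel"
        by (simp, intro borel_open open_UN) simp
      show "cball 0 (R + \<delta>) \<in> fmeasurable lborel"
        using emeasure_bounded_finite[OF bounded_cball, of 0 "R + \<delta>"] by (simp add: fmeasurable_def)
    qed
    finally have "real (card F) * real K * (V * (r / 4) ^ Suc s) \<le> V * (R + \<delta>) ^ Suc s"
      using r R \<delta> by (simp add: content_ball content_cball V_def s card_cartesian_product del: power_Suc)
    then have "V * (real (card F) * real K * (r / 4) ^ Suc s) \<le> V * (R + \<delta>) ^ Suc s"
      by (simp only: mult_ac)
    then have "real (card F) * real K * (r / 4) ^ Suc s \<le> (R + \<delta>) ^ Suc s"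
      using V by (simp only: mult_le_cancel_left_pos)
    moreover have "real (card F) * (\<delta> / (4 * r)) * (r / 4) ^ Suc s \<le> real (card F) * real K * (r / 4) ^ Suc s"
      using K(1) r by (intro mult_right_mono mult_left_mono) auto
    moreover have "real (card F) * (\<delta> / (4 * r)) * (r / 4) ^ Suc s = real (card F) * r ^ s * (\<delta> / 4 ^ Suc (Suc s))"
      using r by (simp add: power_divide)
    ultimately have "real (card F) * r ^ s * (\<delta> / 4 ^ Suc (Suc s)) \<le> (R + \<delta>) ^ Suc s" by linarith
    then show "real (card F) * r ^ (DIM('a) - 1) \<le> (R + \<delta>) ^ Suc s * (4 ^ Suc (Suc s) / \<delta>)"
    proof -
      define q where "q = (4 :: real) ^ Suc (Suc s)"
      have "0 < q" by (simp add: q_def)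
      assume "real (card F) * r ^ s * (\<delta> / 4 ^ Suc (Suc s)) \<le> (R + \<delta>) ^ Suc s"
      then have "real (card F) * r ^ s * (\<delta> / q) * (q / \<delta>) \<le> (R + \<delta>) ^ Suc s * (q / \<delta>)"
        unfolding q_def[symmetric] using \<open>0 < q\<close> \<delta> by (intro mult_right_mono) auto
      then show ?thesis
        unfolding q_def[symmetric] s_def[symmetric] using \<open>0 < q\<close> \<delta> by simp
    qed
  qed
qed

text \<open>
  A maximal separated subset of the boundary provides, at every scale, a covering whose size is
  controlled by the packing bound.
\<close>
lemma hausdorff_outer_frontier_finite:
  fixes S :: "'a::euclidean_space set"
  assumes S: "open S" "bounded S" and ext: "uniform_exterior_sphere S"
  shows "hausdorff_outer (DIM('a) - 1) (frontier S) < \<infinity>"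
proof -
  define s where "s = DIM('a) - 1"
  obtain \<delta> where \<delta>: "0 < \<delta>" "\<And>y. y \<in> frontier S \<Longrightarrow> \<exists>z. cball z \<delta> \<inter> closure S = {y}"
    using ext unfolding uniform_exterior_sphere_def by blast
  obtain B where B: "\<And>F r. finite F \<Longrightarrow> F \<subseteq> frontier S \<Longrightarrow> 0 < r \<Longrightarrow> 4 * r \<le> \<delta> \<Longrightarrow>
    (\<And>x y. x \<in> F \<Longrightarrow> y \<in> F \<Longrightarrow> x \<noteq> y \<Longrightarrow> r \<le> dist x y) \<Longrightarrow> real (card F) * r ^ s \<le> B"
    using frontier_packing_bound[OF S \<delta>] unfolding s_def by metis
  define V where "V = unit_ball_vol (real s)"
  have V: "0 \<le> V" by (simp add: V_def)
  have "hausdorff_premeasure s \<epsilon> (frontier S) \<le> ennreal (V * B)" if \<epsilon>: "0 < \<epsilon>" for \<epsilon>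
  proof -
    define r where "r = min (\<delta> / 4) (\<epsilon> / 2)"
    have r: "0 < r" "4 * r \<le> \<delta>" "2 * r \<le> \<epsilon>" using \<epsilon> \<delta>(1) by (auto simp: r_def)
    define sepd where "sepd F \<longleftrightarrow> finite F \<and> F \<subseteq> frontier S \<and>
      (\<forall>x\<in>F. \<forall>y\<in>F. x \<noteq> y \<longrightarrow> r \<le> dist x y)" for F
    have card_bound: "real (card F) * r ^ s \<le> B" if "sepd F" for F
      by (rule B) (use that r in \<open>auto simp: sepd_def\<close>)
    have bound: "\<forall>F. sepd F \<longrightarrow> card F < Suc (nat \<lceil>B / r ^ s\<rceil>)"
    proof (intro allI impI)
      fix F assume "sepd F"
      then have "real (card F) \<le> B / r ^ s" using card_bound r(1) by (simp add: field_simps)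
      then show "card F < Suc (nat \<lceil>B / r ^ s\<rceil>)" by linarith
    qed
    have "sepd {}" by (simp add: sepd_def)
    then obtain F where F: "sepd F" "\<And>F'. sepd F' \<Longrightarrow> card F' \<le> card F"
      using ex_has_greatest_nat[OF _ bound] by metis
    have finF: "finite F" using F(1) by (simp add: sepd_def)
    have cover: "frontier S \<subseteq> (\<Union>x\<in>F. cball x r)"
    proof
      fix y assume y: "y \<in> frontier S"
      show "y \<in> (\<Union>x\<in>F. cball x r)"
      proof (rule ccontr)
        assume no: "y \<notin> (\<Union>x\<in>F. cball x r)"
        then have "sepd (insert y F)"
          using F(1) y by (auto simp: sepd_def dist_commute less_imp_le)
        then have "card (insert y F) \<le> card F" by (rule F(2))
        moreover have "y \<notin> F" using no r(1) by force
        ultimately show False using finF by simp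
      qed
    qed
    obtain xs where xs: "set xs = F" "distinct xs"
      using finite_distinct_list[OF finF] by blast
    define C where "C i = (if i < length xs then cball (xs ! i) r else {})" for i
    have "hausdorff_premeasure s \<epsilon> (frontier S) \<le> (\<Sum>i. hausdorff_gauge s (C i))"
    proof (rule hausdorff_premeasure_le)
      show "frontier S \<subseteq> (\<Union>i. C i)"
      proof
        fix y assume "y \<in> frontier S"
        then obtain x where "x \<in> F" "y \<in> cball x r" using cover by blast
        moreover then obtain i where "i < length xs" "x = xs ! i" using xs(1) by (metis in_set_conv_nth)
        ultimately show "y \<in> (\<Union>i. C i)" by (auto simp: C_def intro!: exI[of _ i])
      qed
    qed (use r in \<open>auto simp: C_def diameter_cball\<close>)
    also have "\<dots> = (\<Sum>i<length xs. hausdorff_gauge s (C i))"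
      by (rule suminf_finite) (auto simp: C_def)
    also have "\<dots> = (\<Sum>i<length xs. ennreal (V * r ^ s))"
      using r(1) by (intro sum.cong) (auto simp: C_def hausdorff_gauge_def diameter_cball V_def)
    also have "\<dots> = ennreal (V * (real (card F) * r ^ s))"
      using xs r(1) V by (simp add: distinct_card[symmetric] ennreal_of_nat_eq_real_of_nat ennreal_mult[symmetric] mult_ac)
    also have "\<dots> \<le> ennreal (V * B)"
      using card_bound[OF F(1)] V by (intro ennreal_leI mult_left_mono)
    finally show ?thesis .
  qed
  then have "hausdorff_outer s (frontier S) \<le> ennreal (V * B)"
    unfolding hausdorff_outer_def by (intro SUP_least) auto
  then show ?thesis by (simp add: s_def le_less_trans)
qed

section \<open>Functions concentrated on a cap\<close>

text \<open>
  A lower bound for the surface measure of the boundary of the cap by projection along \<open>e\<close>. Measuring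
  the projection through cylinders of height \<open>M - t\<close> keeps the argument within \<open>n\<close>-dimensional Lebesgue
  measure.
\<close>
lemma cap_volume_le_surface:
  fixes S :: "'a::euclidean_space set"
  assumes S: "open S" "bounded S" and e: "e \<in> Basis" and M: "\<And>x. x \<in> closure S \<Longrightarrow> x \<bullet> e \<le> M"
    and t: "t \<le> M" and fin: "hausdorff_outer (DIM('a) - 1) (frontier S) < \<infinity>"
  shows "measure lborel {x \<in> S. t < x \<bullet> e}
    \<le> 4 ^ (DIM('a) - 1) / unit_ball_vol (real (DIM('a) - 1)) * (M - t) * measure surface_measure {x \<in> frontier S. t < x \<bullet> e}"
proof -
  define s where "s = DIM('a) - 1"
  define V where "V = unit_ball_vol (real s)"
  have V: "0 < V" by (simp add: V_def)
  define c where "c = 4 ^ s / V * (M - t)"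
  have c: "0 \<le> c" using V t by (simp add: c_def)
  define Fr where "Fr = {x \<in> frontier S. t < x \<bullet> e}"
  define Cap where "Cap = {x \<in> S. t < x \<bullet> e}"
  have half: "{x. t < x \<bullet> e} = {x. e \<bullet> x > t}" by (simp add: inner_commute)
  have FrB: "Fr \<in> sets borel"
    using borel_closed[OF frontier_closed[of S]] borel_open[OF open_halfspace_gt[of t e]]
    by (simp add: Fr_def Collect_conj_eq half)
  have Cap: "open Cap" "bounded Cap"
    using open_Int[OF S(1) open_halfspace_gt[of t e]] bounded_subset[OF S(2)]
    by (auto simp: Cap_def Collect_conj_eq half)
  have "hausdorff_outer s Fr \<le> hausdorff_outer s (frontier S)"
    by (intro hausdorff_outer_mono) (auto simp: Fr_def)
  then have finFr: "hausdorff_outer s Fr < \<infinity>" using fin by (auto simp: s_def intro: le_less_trans)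
  define h where "h = enn2real (hausdorff_outer s Fr)"
  have h: "hausdorff_outer s Fr = ennreal h" "0 \<le> h" using finFr by (simp_all add: h_def)
  have exit: "\<exists>y\<in>Fr. x \<bullet> e \<le> y \<bullet> e \<and> (\<forall>b\<in>Basis. b \<noteq> e \<longrightarrow> x \<bullet> b = y \<bullet> b)" if x: "x \<in> Cap" for x
  proof -
    \<comment> \<open>This point lies beyond \<open>closure S\<close> on the ray from \<open>x\<close> in direction \<open>e\<close>.\<close>
    define q where "q = x + (M - x \<bullet> e + 1) *\<^sub>R e"
    have "q \<bullet> e = M + 1" using e by (simp add: q_def inner_add_left)
    then have "q \<notin> S" using M closure_subset by force
    moreover have "x \<in> S" using x by (simp add: Cap_def)
    ultimately have "closed_segment x q \<inter> frontier S \<noteq> {}"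
      by (intro connected_Int_frontier connected_segment) auto
    then obtain y where y: "y \<in> frontier S" "y \<in> closed_segment x q" by blast
    then obtain w where w: "0 \<le> w" "y = x + (w * (M - x \<bullet> e + 1)) *\<^sub>R e"
      by (auto simp: in_segment q_def algebra_simps)
    have xM: "x \<bullet> e \<le> M" using M x closure_subset by (auto simp: Cap_def)
    have "y \<bullet> e = x \<bullet> e + w * (M - x \<bullet> e + 1)" using e w(2) by (simp add: inner_add_left)
    then have "x \<bullet> e \<le> y \<bullet> e" using w(1) xM by simp
    moreover have "x \<bullet> b = y \<bullet> b" if "b \<in> Basis" "b \<noteq> e" for b
      using e that w(2) by (simp add: inner_add_left inner_Basis)
    ultimately show ?thesis using y(1) x by (intro bexI[of _ y]) (auto simp: Fr_def Cap_def)
  qed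
  have "emeasure lborel Cap \<le> ennreal (c * (h + \<epsilon>))" if \<epsilon>: "0 < \<epsilon>" for \<epsilon>
  proof -
    have "hausdorff_premeasure s 1 Fr < ennreal (h + \<epsilon>)"
    proof (rule le_less_trans)
      show "hausdorff_premeasure s 1 Fr \<le> ennreal h"
        using hausdorff_premeasure_le_outer[of 1 s Fr] h by simp
      show "ennreal h < ennreal (h + \<epsilon>)"
        using \<epsilon> h(2) by (simp add: ennreal_less_iff)
    qed
    then obtain C :: "nat \<Rightarrow> 'a set" where C: "Fr \<subseteq> (\<Union>i. C i)" "\<And>i. bounded (C i)"
      "\<And>i. diameter (C i) \<le> 1" "(\<Sum>i. hausdorff_gauge s (C i)) < ennreal (h + \<epsilon>)"
      by (rule hausdorff_coverE) (rule that)
    \<comment> \<open>The part of the cap that leaves through a covering set of diameter \<open>d\<close> lies in a box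
      with cross-section of side length \<open>2 * d\<close> and height \<open>M - t\<close>.\<close>
    define d where "d i = diameter (C i)" for i
    define y where "y i = (SOME y. y \<in> C i)" for i
    define lo where "lo i = (\<Sum>b\<in>Basis. (if b = e then t else y i \<bullet> b - d i) *\<^sub>R b)" for i
    define hi where "hi i = (\<Sum>b\<in>Basis. (if b = e then M else y i \<bullet> b + d i) *\<^sub>R b)" for i
    define Q where "Q i = (if C i = {} then {} else cbox (lo i) (hi i))" for i
    have d: "0 \<le> d i" for i using diameter_ge_0[OF C(2)] by (simp add: d_def)
    have lohi: "lo i \<bullet> b = (if b = e then t else y i \<bullet> b - d i)" "hi i \<bullet> b = (if b = e then M else y i \<bullet> b + d i)"
      if "b \<in> Basis" for b i
      using that by (simp_all add: lo_def hi_def)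
    have "Cap \<subseteq> (\<Union>i. Q i)"
    proof
      fix x assume x: "x \<in> Cap"
      obtain p where p: "p \<in> Fr" "x \<bullet> e \<le> p \<bullet> e" "\<And>b. b \<in> Basis \<Longrightarrow> b \<noteq> e \<Longrightarrow> x \<bullet> b = p \<bullet> b"
        using exit[OF x] by blast
      obtain i where i: "p \<in> C i" using C(1) p(1) by blast
      have "y i \<in> C i" unfolding y_def using i by (rule someI)
      then have "dist p (y i) \<le> d i"
        unfolding d_def using i C(2) by (intro diameter_bounded_bound)
      then have pb: "\<bar>p \<bullet> b - y i \<bullet> b\<bar> \<le> d i" if "b \<in> Basis" for b
        using Basis_le_norm[OF that, of "p - y i"] by (simp add: dist_norm inner_diff_left)
      have "t \<le> x \<bullet> e" "x \<bullet> e \<le> M"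
        using x M closure_subset by (auto simp: Cap_def)
      then have "x \<in> cbox (lo i) (hi i)"
        using pb p(3) by (auto simp: mem_box lohi abs_le_iff algebra_simps)
      then show "x \<in> (\<Union>i. Q i)" using i by (auto simp: Q_def intro!: exI[of _ i])
    qed
    moreover have Qs: "Q i \<in> sets lborel" for i by (simp add: Q_def)
    ultimately have "emeasure lborel Cap \<le> emeasure lborel (\<Union>i. Q i)"
      by (intro emeasure_mono) auto
    also have "\<dots> \<le> (\<Sum>i. emeasure lborel (Q i))"
      using Qs by (intro emeasure_subadditive_countably) auto
    also have "\<dots> \<le> (\<Sum>i. ennreal c * hausdorff_gauge s (C i))"
    proof (rule suminf_le)
      fix i
      show "emeasure lborel (Q i) \<le> ennreal c * hausdorff_gauge s (C i)"
      proof (cases "C i = {}")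
        case False
        have "emeasure lborel (Q i) = ennreal (\<Prod>b\<in>Basis. (hi i - lo i) \<bullet> b)"
          using False d[of i] t by (simp add: Q_def emeasure_lborel_cbox_eq lohi)
        also have "(\<Prod>b\<in>Basis. (hi i - lo i) \<bullet> b) = (M - t) * (\<Prod>b\<in>Basis - {e}. (hi i - lo i) \<bullet> b)"
          using e by (subst prod.remove[OF _ e]) (auto simp: inner_diff_left lohi)
        also have "(\<Prod>b\<in>Basis - {e}. (hi i - lo i) \<bullet> b) = (\<Prod>b\<in>Basis - {e}. 2 * d i)"
          by (intro prod.cong) (auto simp: inner_diff_left lohi)
        also have "\<dots> = (2 * d i) ^ s"
          using e by (simp add: s_def card_Diff_singleton)
        also have "(2 * d i) ^ s = 4 ^ s * (d i / 2) ^ s"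
          by (subst power_mult_distrib[symmetric]) simp
        also have "(M - t) * (4 ^ s * (d i / 2) ^ s) = c * (V * (d i / 2) ^ s)"
          using V by (simp add: c_def)
        also have "ennreal (c * (V * (d i / 2) ^ s)) = ennreal c * hausdorff_gauge s (C i)"
          using False c V d[of i] by (simp add: hausdorff_gauge_def V_def d_def ennreal_mult)
        finally show ?thesis by simp
      qed (simp add: Q_def)
    qed auto
    also have "\<dots> = ennreal c * (\<Sum>i. hausdorff_gauge s (C i))"
      by simp
    also have "\<dots> \<le> ennreal c * ennreal (h + \<epsilon>)"
      using C(4) by (intro mult_left_mono) auto
    also have "\<dots> = ennreal (c * (h + \<epsilon>))"
      using c h(2) \<epsilon> by (intro ennreal_mult[symmetric]) auto
    finally show ?thesis .
  qed
  then have le: "measure lborel Cap \<le> c * (h + \<epsilon>)" if "0 < \<epsilon>" for \<epsilon>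
    using that c h(2) unfolding measure_def by (intro enn2real_leI) auto
  have "measure lborel Cap \<le> c * h"
  proof (rule field_le_epsilon)
    fix \<epsilon> :: real assume "0 < \<epsilon>"
    then have "measure lborel Cap \<le> c * (h + \<epsilon> / (c + 1))" using c by (intro le) auto
    also have "\<dots> \<le> c * h + \<epsilon>" using c \<open>0 < \<epsilon>\<close> by (simp add: field_simps)
    finally show "measure lborel Cap \<le> c * h + \<epsilon>" .
  qed
  also have "h = measure surface_measure Fr"
    using measure_hausdorff_measure[OF FrB] by (simp add: surface_measure_def h_def s_def)
  finally show ?thesis by (simp add: c_def s_def V_def Cap_def Fr_def)
qed

text \<open>
  A discrete layer-cake formula: both bounds compare the summands with the increments of the
  telescoping function \<open>f j = max 0 (v - (t + j * \<eta>))\<close>.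
\<close>
lemma layer_sum_bounds:
  fixes t \<eta> v :: real
  assumes "0 \<le> \<eta>"
  shows "v \<le> t + real N * \<eta> \<Longrightarrow> max 0 (v - t) \<le> (\<Sum>j<N. \<eta> * of_bool (t + real j * \<eta> < v))"
    and "(\<Sum>j<N. \<eta> * of_bool (t + real j * \<eta> < v)) \<le> max 0 (v - t) + \<eta>"
proof -
  define f where "f j = max 0 (v - (t + real j * \<eta>))" for j :: nat
  have tele: "(\<Sum>j<n. f j - f (Suc j)) = f 0 - f n" for n
    by (rule sum_lessThan_telescope')
  have step: "f j - f (Suc j) \<le> \<eta> * of_bool (t + real j * \<eta> < v)"
    "\<eta> * of_bool (t + real (Suc j) * \<eta> < v) \<le> f j - f (Suc j)" for j
    using assms by (auto simp: f_def max_def algebra_simps)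
  show "max 0 (v - t) \<le> (\<Sum>j<N. \<eta> * of_bool (t + real j * \<eta> < v))" if "v \<le> t + real N * \<eta>"
  proof -
    have "max 0 (v - t) = (\<Sum>j<N. f j - f (Suc j))"
      using that by (simp add: tele) (simp add: f_def)
    also have "\<dots> \<le> (\<Sum>j<N. \<eta> * of_bool (t + real j * \<eta> < v))"
      by (intro sum_mono step)
    finally show ?thesis .
  qed
  show "(\<Sum>j<N. \<eta> * of_bool (t + real j * \<eta> < v)) \<le> max 0 (v - t) + \<eta>"
  proof (cases N)
    case (Suc n)
    have "(\<Sum>j<Suc n. \<eta> * of_bool (t + real j * \<eta> < v))
        = \<eta> * of_bool (t < v) + (\<Sum>j<n. \<eta> * of_bool (t + real (Suc j) * \<eta> < v))"
      by (subst sum.lessThan_Suc_shift) simp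
    also have "\<dots> \<le> \<eta> + (\<Sum>j<n. f j - f (Suc j))"
      using assms by (intro add_mono sum_mono step) auto
    also have "\<dots> \<le> \<eta> + max 0 (v - t)"
      by (simp add: tele) (simp add: f_def)
    finally show ?thesis by (simp add: Suc)
  qed (use assms in simp)
qed

lemma integral_layer_sum:
  fixes g :: "'a \<Rightarrow> real"
  assumes A: "A \<in> sets M" "emeasure M A < \<infinity>" and \<eta>: "0 \<le> \<eta>"
    and meas: "\<And>t. {x \<in> A. t < g x} \<in> sets M"
    and int: "set_integrable M A (\<lambda>x. max 0 (g x - t))"
  shows "(\<And>x. x \<in> A \<Longrightarrow> g x \<le> t + real N * \<eta>) \<Longrightarrow>
      (LINT x:A|M. max 0 (g x - t)) \<le> (\<Sum>j<N. \<eta> * measure M {x \<in> A. t + real j * \<eta> < g x})"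
    and "(\<Sum>j<N. \<eta> * measure M {x \<in> A. t + real j * \<eta> < g x})
      \<le> (LINT x:A|M. max 0 (g x - t)) + \<eta> * measure M A"
proof -
  define L where "L x = (\<Sum>j<N. \<eta> * indicator {x \<in> A. t + real j * \<eta> < g x} x)" for x
  have fin: "emeasure M {x \<in> A. a < g x} < \<infinity>" for a
    by (rule le_less_trans[OF emeasure_mono A(2)]) (use A in auto)
  have L: "integrable M L"
    unfolding L_def using meas fin
    by (intro Bochner_Integration.integrable_sum integrable_mult_right integrable_real_indicator)
  have sum_eq: "(\<Sum>j<N. \<eta> * measure M {x \<in> A. t + real j * \<eta> < g x}) = (LINT x|M. L x)"
    unfolding L_def using meas fin by (subst Bochner_Integration.integral_sum) auto
  have L_eq: "L x = indicator A x *\<^sub>R (\<Sum>j<N. \<eta> * of_bool (t + real j * \<eta> < g x))" for x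
    by (auto simp: L_def indicator_def intro!: sum.cong)
  note int' = int[unfolded set_integrable_def]
  show "(LINT x:A|M. max 0 (g x - t)) \<le> (\<Sum>j<N. \<eta> * measure M {x \<in> A. t + real j * \<eta> < g x})"
    if "\<And>x. x \<in> A \<Longrightarrow> g x \<le> t + real N * \<eta>"
    unfolding sum_eq set_lebesgue_integral_def
  proof (rule integral_mono[OF int' L])
    fix x
    show "indicator A x *\<^sub>R max 0 (g x - t) \<le> L x"
      unfolding L_eq using layer_sum_bounds(1)[OF \<eta>, of "g x" t N] that[of x]
      by (cases "x \<in> A") auto
  qed
  have "(LINT x|M. L x) \<le> (LINT x|M. indicator A x *\<^sub>R max 0 (g x - t) + \<eta> * indicator A x)"
  proof (rule integral_mono[OF L])
    show "integrable M (\<lambda>x. indicator A x *\<^sub>R max 0 (g x - t) + \<eta> * indicator A x)"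
      using A by (intro Bochner_Integration.integrable_add int' integrable_mult_right integrable_real_indicator)
    show "L x \<le> indicator A x *\<^sub>R max 0 (g x - t) + \<eta> * indicator A x" for x
      unfolding L_eq using layer_sum_bounds(2)[OF \<eta>, of t "g x" N]
      by (cases "x \<in> A") auto
  qed
  also have "\<dots> = (LINT x:A|M. max 0 (g x - t)) + \<eta> * measure M A"
    unfolding set_lebesgue_integral_def using A
    by (subst Bochner_Integration.integral_add[OF int']) auto
  finally show "(\<Sum>j<N. \<eta> * measure M {x \<in> A. t + real j * \<eta> < g x})
      \<le> (LINT x:A|M. max 0 (g x - t)) + \<eta> * measure M A"
    unfolding sum_eq .
qed

text \<open>
  The bound for the single caps is added up over the levels \<open>t + j * \<eta>\<close>; the discretisation error
  vanishes as the step \<open>\<eta>\<close> tends to zero.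
\<close>
lemma ramp_volume_le_surface:
  fixes S :: "'a::euclidean_space set"
  assumes S: "open S" "bounded S" and e: "e \<in> Basis" and M: "\<And>x. x \<in> closure S \<Longrightarrow> x \<bullet> e \<le> M"
    and t: "t < M" and fin: "hausdorff_outer (DIM('a) - 1) (frontier S) < \<infinity>"
  shows "(LINT x:S|lborel. max 0 (x \<bullet> e - t))
    \<le> 4 ^ (DIM('a) - 1) / unit_ball_vol (real (DIM('a) - 1)) * (M - t)
      * (LINT x:frontier S|surface_measure. max 0 (x \<bullet> e - t))"
proof -
  define c where "c = (4 ^ (DIM('a) - 1) / unit_ball_vol (real (DIM('a) - 1)) :: real)"
  have c: "0 < c" by (simp add: c_def)
  define Fr where "Fr = frontier S"
  define \<mu> where "\<mu> = (surface_measure :: 'a measure)"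
  have fr: "Fr \<subseteq> closure S" by (simp add: Fr_def frontier_def)
  have half: "{x \<in> X. a < x \<bullet> e} = X \<inter> {x. e \<bullet> x > a}" for X a by (auto simp: inner_commute)
  have sets_mu: "sets \<mu> = sets borel" by (simp add: \<mu>_def surface_measure_def)
  have FrB: "Fr \<in> sets borel" by (simp add: Fr_def)
  have muF: "emeasure \<mu> Fr < \<infinity>"
    using fin FrB by (simp add: \<mu>_def Fr_def surface_measure_def emeasure_hausdorff_measure)
  have SB: "S \<in> sets borel" using S(1) by simp
  have cont: "continuous_on X (\<lambda>x. max 0 (x \<bullet> e - t))" for X
    by (intro continuous_intros continuous_on_max)
  have intS: "set_integrable lborel S (\<lambda>x. max 0 (x \<bullet> e - t))"
    by (intro set_integrable_continuous_closure S SB cont)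
  have intF: "set_integrable \<mu> Fr (\<lambda>x. max 0 (x \<bullet> e - t))"
    using S(2) by (intro integrable_on_compact_finite_measure sets_mu muF cont) (simp add: Fr_def compact_frontier_bounded)
  have step: "(LINT x:S|lborel. max 0 (x \<bullet> e - t)) \<le> c * (M - t) * (LINT x:Fr|\<mu>. max 0 (x \<bullet> e - t))
      + c * (M - t) * ((M - t) / real (Suc n) * measure \<mu> Fr)" for n
  proof -
    define \<eta> where "\<eta> = (M - t) / real (Suc n)"
    have \<eta>: "0 \<le> \<eta>" "real (Suc n) * \<eta> = M - t" using t by (auto simp: \<eta>_def)
    have low: "t + real j * \<eta> \<le> M" if "j < Suc n" for j
      using mult_right_mono[of "real j" "real (Suc n)" \<eta>] that \<eta> by simp
    have "(LINT x:S|lborel. max 0 (x \<bullet> e - t)) \<le> (\<Sum>j<Suc n. \<eta> * measure lborel {x \<in> S. t + real j * \<eta> < x \<bullet> e})"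
    proof (rule integral_layer_sum(1))
      show "emeasure lborel S < \<infinity>" using emeasure_bounded_finite[OF S(2)] by simp
      show "x \<bullet> e \<le> t + real (Suc n) * \<eta>" if "x \<in> S" for x
        using M[of x] that closure_subset \<eta>(2) by auto
    qed (use SB \<eta> intS in \<open>auto simp: half simp del: of_nat_Suc\<close>)
    also have "\<dots> \<le> (\<Sum>j<Suc n. \<eta> * (c * (M - t) * measure \<mu> {x \<in> Fr. t + real j * \<eta> < x \<bullet> e}))"
    proof (intro sum_mono mult_left_mono \<eta>(1))
      fix j assume "j \<in> {..<Suc n}"
      then have j: "t + real j * \<eta> \<le> M" by (intro low) simp
      have "measure lborel {x \<in> S. t + real j * \<eta> < x \<bullet> e}
          \<le> c * (M - (t + real j * \<eta>)) * measure \<mu> {x \<in> Fr. t + real j * \<eta> < x \<bullet> e}"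
        unfolding c_def \<mu>_def Fr_def by (rule cap_volume_le_surface[OF S e M j fin])
      also have "\<dots> \<le> c * (M - t) * measure \<mu> {x \<in> Fr. t + real j * \<eta> < x \<bullet> e}"
        using c \<eta>(1) by (intro mult_right_mono mult_left_mono) auto
      finally show "measure lborel {x \<in> S. t + real j * \<eta> < x \<bullet> e}
          \<le> c * (M - t) * measure \<mu> {x \<in> Fr. t + real j * \<eta> < x \<bullet> e}" .
    qed
    also have "\<dots> = c * (M - t) * (\<Sum>j<Suc n. \<eta> * measure \<mu> {x \<in> Fr. t + real j * \<eta> < x \<bullet> e})"
      by (simp only: sum_distrib_left mult_ac)
    also have "\<dots> \<le> c * (M - t) * ((LINT x:Fr|\<mu>. max 0 (x \<bullet> e - t)) + \<eta> * measure \<mu> Fr)"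
    proof (intro mult_left_mono integral_layer_sum(2) muF \<eta>(1) intF)
      show "{x \<in> Fr. a < x \<bullet> e} \<in> sets \<mu>" for a
        unfolding half sets_mu using FrB by (intro sets.Int) auto
    qed (use FrB sets_mu c t in auto)
    finally show ?thesis by (simp add: \<eta>_def distrib_left)
  qed
  have "(LINT x:S|lborel. max 0 (x \<bullet> e - t)) \<le> c * (M - t) * (LINT x:Fr|\<mu>. max 0 (x \<bullet> e - t))"
  proof (rule LIMSEQ_le_const)
    have "(\<lambda>n. c * (M - t) * (LINT x:Fr|\<mu>. max 0 (x \<bullet> e - t)) + c * (M - t) * ((M - t) / real (Suc n) * measure \<mu> Fr))
        \<longlonglongrightarrow> c * (M - t) * (LINT x:Fr|\<mu>. max 0 (x \<bullet> e - t)) + c * (M - t) * (0 * measure \<mu> Fr)"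
      by (intro tendsto_intros LIMSEQ_Suc[OF lim_const_over_n])
    then show "(\<lambda>n. c * (M - t) * (LINT x:Fr|\<mu>. max 0 (x \<bullet> e - t)) + c * (M - t) * ((M - t) / real (Suc n) * measure \<mu> Fr))
        \<longlonglongrightarrow> c * (M - t) * (LINT x:Fr|\<mu>. max 0 (x \<bullet> e - t))" by simp
  qed (use step in blast)
  then show ?thesis by (simp add: c_def Fr_def \<mu>_def)
qed

section \<open>The comparison of averages\<close>

lemma measure_lborel_open_pos:
  fixes S :: "'a::euclidean_space set"
  assumes "open S" "bounded S" "S \<noteq> {}"
  shows "0 < measure lborel S"
proof -
  obtain x r where r: "0 < r" "ball x r \<subseteq> S"
    using assms by (meson ex_in_conv open_contains_ball)
  have "0 < measure lborel (ball x r)"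
    using r(1) by (simp add: content_ball)
  also have "\<dots> \<le> measure lborel S"
    using r(2) assms emeasure_bounded_finite[of S]
    by (intro measure_mono_fmeasurable) (auto simp: fmeasurable_def)
  finally show ?thesis .
qed

lemma set_integral_pos_open:
  fixes f :: "'a::euclidean_space \<Rightarrow> real"
  assumes S: "open S" "bounded S" and f: "continuous_on (closure S) f" "\<And>x. x \<in> S \<Longrightarrow> 0 \<le> f x"
    and x: "x \<in> S" "0 < f x"
  shows "0 < (LINT x:S|lborel. f x)"
proof -
  define T where "T = S \<inter> f -` {f x / 2<..}"
  have "open T"
    unfolding T_def using S(1) continuous_on_subset[OF f(1) closure_subset]
    by (intro continuous_open_preimage) auto
  moreover have "bounded T" "T \<noteq> {}" using bounded_subset[OF S(2)] x by (auto simp: T_def)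
  ultimately have "0 < f x / 2 * measure lborel T"
    using x measure_lborel_open_pos[of T] by simp
  also have "\<dots> = (LINT y|lborel. f x / 2 * indicator T y)"
    using \<open>open T\<close> \<open>bounded T\<close> emeasure_bounded_finite[of T] by simp
  also have "\<dots> \<le> (LINT y|lborel. indicator S y *\<^sub>R f y)"
  proof (rule integral_mono)
    show "integrable lborel (\<lambda>y. f x / 2 * indicator T y)"
      using \<open>open T\<close> \<open>bounded T\<close> emeasure_bounded_finite[of T]
      by (intro integrable_mult_right integrable_real_indicator) auto
    show "integrable lborel (\<lambda>y. indicator S y *\<^sub>R f y)"
      using set_integrable_continuous_closure[OF S(2) _ f(1)] S(1) by (simp add: set_integrable_def)
    show "f x / 2 * indicator T y \<le> indicator S y *\<^sub>R f y" for y
      using f(2)[of y] by (auto simp: T_def indicator_def)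
  qed
  finally show ?thesis by (simp add: set_lebesgue_integral_def)
qed

theorem theorem1p4:
  fixes \<Omega> :: "'a::euclidean_space set"
  assumes "open \<Omega>" and "connected \<Omega>" and "\<Omega> \<noteq> {}" and "bounded \<Omega>"
    and "uniform_exterior_sphere \<Omega>"
  shows "(\<exists>c\<^sub>2::real. 1 \<le> c\<^sub>2 \<and>
            (\<forall>h :: 'a \<Rightarrow> real.
               harmonic_on \<Omega> h \<and> continuous_on (closure \<Omega>) h \<and> (\<forall>x\<in>\<Omega>. 0 \<le> h x) \<longrightarrow>
               1 / measure lborel \<Omega> * (LINT x:\<Omega>|lborel. h x)
                 \<le> c\<^sub>2 / measure surface_measure (frontier \<Omega>)
                     * (LINT x:frontier \<Omega>|surface_measure. h x)) \<and>
            (\<forall>u :: 'a \<Rightarrow> real.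
               subharmonic_on \<Omega> u \<and> continuous_on (closure \<Omega>) u \<and> (\<forall>x\<in>\<Omega>. 0 \<le> u x) \<longrightarrow>
               1 / measure lborel \<Omega> * (LINT x:\<Omega>|lborel. u x)
                 \<le> c\<^sub>2 / measure surface_measure (frontier \<Omega>)
                     * (LINT x:frontier \<Omega>|surface_measure. u x))) \<and>
         (\<exists>u :: nat \<Rightarrow> 'a \<Rightarrow> real.
            (\<forall>k. subharmonic_on \<Omega> (u k) \<and> continuous_on (closure \<Omega>) (u k) \<and>
                 (\<forall>x\<in>closure \<Omega>. 0 < u k x)) \<and>
            bounded (range (\<lambda>k. 1 / measure lborel \<Omega> * (LINT x:\<Omega>|lborel. u k x))) \<and>
            \<not> bounded (range (\<lambda>k. 1 / measure surface_measure (frontier \<Omega>)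
                                     * (LINT x:frontier \<Omega>|surface_measure. u k x))))"
proof -
  note S = assms(1,4)
  define \<mu> where "\<mu> = (surface_measure :: 'a measure)"
  define m where "m = measure lborel \<Omega>"
  define H where "H = measure \<mu> (frontier \<Omega>)"
  have m: "0 < m" unfolding m_def by (rule measure_lborel_open_pos[OF S assms(3)])
  note fin = hausdorff_outer_frontier_finite[OF S assms(5)]
  have sets_mu: "sets \<mu> = sets borel" by (simp add: \<mu>_def surface_measure_def)
  have muF: "emeasure \<mu> (frontier \<Omega>) < \<infinity>"
    using fin by (simp add: \<mu>_def surface_measure_def emeasure_hausdorff_measure)
  have SB: "\<Omega> \<in> sets borel" using S(1) by simp
  have mS: "emeasure lborel \<Omega> < \<infinity>" using emeasure_bounded_finite[OF S(2)] by simp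
  have fr: "frontier \<Omega> \<subseteq> closure \<Omega>" by (simp add: frontier_def)
  have const_harmonic: "harmonic_on X (\<lambda>_. c)" for X :: "'a set" and c
    using harmonic_on_affine[of X 0 c] by simp
  obtain C where C: "0 < C"
    "\<And>u. subharmonic_on \<Omega> u \<Longrightarrow> continuous_on (closure \<Omega>) u \<Longrightarrow> (\<And>x. x \<in> \<Omega> \<Longrightarrow> 0 \<le> u x) \<Longrightarrow>
      (LINT x:\<Omega>|lborel. u x) \<le> C * (LINT x:frontier \<Omega>|\<mu>. u x)"
    using subharmonic_volume_le_surface[OF S assms(5) fin] unfolding \<mu>_def by metis
  have H: "0 < H"
  proof -
    have "(LINT x:\<Omega>|lborel. 1) \<le> C * (LINT x:frontier \<Omega>|\<mu>. 1)"
      by (intro C(2) harmonic_on_imp_subharmonic_on const_harmonic) auto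
    moreover have "(LINT x:\<Omega>|lborel. 1) = m"
      using SB mS by (simp add: set_lebesgue_integral_def m_def)
    moreover have "(LINT x:frontier \<Omega>|\<mu>. 1) = H"
      using muF sets_mu by (simp add: set_lebesgue_integral_def H_def)
    ultimately have "0 < C * H" using m by simp
    then show ?thesis using C(1) by (simp add: zero_less_mult_iff)
  qed
  have ineq: "1 / m * (LINT x:\<Omega>|lborel. u x) \<le> max 1 (C * H / m) / H * (LINT x:frontier \<Omega>|\<mu>. u x)"
    if u: "subharmonic_on \<Omega> u" "continuous_on (closure \<Omega>) u" "\<forall>x\<in>\<Omega>. 0 \<le> u x" for u
  proof -
    have "0 \<le> u x" if "x \<in> frontier \<Omega>" for x
      using continuous_ge_on_closure[OF u(2), of x 0] u(3) that fr by blast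
    then have "0 \<le> (LINT x:frontier \<Omega>|\<mu>. u x)"
      unfolding set_lebesgue_integral_def by (intro integral_nonneg_AE) (auto simp: indicator_def)
    moreover have "C / m \<le> max 1 (C * H / m) / H"
    proof -
      have "C / m = (C * H / m) / H" using H by simp
      also have "\<dots> \<le> max 1 (C * H / m) / H" using H by (intro divide_right_mono) auto
      finally show ?thesis .
    qed
    ultimately have "C / m * (LINT x:frontier \<Omega>|\<mu>. u x) \<le> max 1 (C * H / m) / H * (LINT x:frontier \<Omega>|\<mu>. u x)"
      by (intro mult_right_mono)
    moreover have "1 / m * (LINT x:\<Omega>|lborel. u x) \<le> 1 / m * (C * (LINT x:frontier \<Omega>|\<mu>. u x))"
      using m u by (intro mult_left_mono C(2)) auto
    ultimately show ?thesis by simp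
  qed
  have first: "\<exists>c\<^sub>2::real. 1 \<le> c\<^sub>2 \<and>
      (\<forall>h. harmonic_on \<Omega> h \<and> continuous_on (closure \<Omega>) h \<and> (\<forall>x\<in>\<Omega>. 0 \<le> h x) \<longrightarrow>
         1 / m * (LINT x:\<Omega>|lborel. h x) \<le> c\<^sub>2 / H * (LINT x:frontier \<Omega>|\<mu>. h x)) \<and>
      (\<forall>u. subharmonic_on \<Omega> u \<and> continuous_on (closure \<Omega>) u \<and> (\<forall>x\<in>\<Omega>. 0 \<le> u x) \<longrightarrow>
         1 / m * (LINT x:\<Omega>|lborel. u x) \<le> c\<^sub>2 / H * (LINT x:frontier \<Omega>|\<mu>. u x))"
    using ineq harmonic_on_imp_subharmonic_on
    by (intro exI[of _ "max 1 (C * H / m)"] conjI allI impI) (simp, blast, blast)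
  define e where "e = (SOME b :: 'a. b \<in> Basis)"
  have e: "e \<in> Basis" unfolding e_def by (rule SOME_Basis)
  have "compact (closure \<Omega>)" "closure \<Omega> \<noteq> {}" using S assms(3) by auto
  then obtain q where q: "q \<in> closure \<Omega>" "\<And>x. x \<in> closure \<Omega> \<Longrightarrow> x \<bullet> e \<le> q \<bullet> e"
    using continuous_attains_sup[of "closure \<Omega>" "\<lambda>x. x \<bullet> e"]
      continuous_on_inner[OF continuous_on_id continuous_on_const] by blast
  define c where "c = (4 ^ (DIM('a) - 1) / unit_ball_vol (real (DIM('a) - 1)) :: real)"
  have c: "0 < c" by (simp add: c_def)
  define t where "t k = q \<bullet> e - 1 / real (Suc k)" for k
  have t: "t k < q \<bullet> e" for k by (simp add: t_def)
  define f where "f k x = max 0 (x \<bullet> e - t k)" for k x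
  have f_cont: "continuous_on X (f k)" for X k
    unfolding f_def by (intro continuous_intros continuous_on_max)
  define a where "a k = 1 / (LINT x:\<Omega>|lborel. f k x)" for k
  have f_pos: "0 < (LINT x:\<Omega>|lborel. f k x)" for k
  proof -
    have "open {x. t k < e \<bullet> x}" using open_halfspace_gt[of "t k" e] by simp
    moreover have "q \<in> {x. t k < e \<bullet> x}" using t[of k] by (simp add: inner_commute)
    ultimately have "{x. t k < e \<bullet> x} \<inter> \<Omega> \<noteq> {}"
      using q(1) open_Int_closure_eq_empty by blast
    then obtain x where "x \<in> \<Omega>" "t k < x \<bullet> e" by (auto simp: inner_commute)
    then show ?thesis
      by (intro set_integral_pos_open[OF S f_cont, of _ x]) (auto simp: f_def)
  qed
  have a: "0 < a k" for k using f_pos[of k] by (simp add: a_def)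
  define u where "u k x = 1 + a k * f k x" for k x
  \<comment> \<open>The form that shows subharmonicity: a maximum of affine functions.\<close>
  have u_max: "u k = (\<lambda>x. max 1 ((a k *\<^sub>R e) \<bullet> x + (1 - a k * t k)))" for k
    using a[of k] by (auto simp: u_def f_def fun_eq_iff max_def inner_commute algebra_simps)
  have u_sub: "subharmonic_on \<Omega> (u k)" for k
    unfolding u_max by (intro subharmonic_on_max harmonic_on_imp_subharmonic_on const_harmonic harmonic_on_affine)
  have u_cont: "continuous_on X (u k)" for X k
    unfolding u_def by (intro continuous_intros f_cont)
  have u_pos: "0 < u k x" for k x
    using a[of k] by (simp add: u_def f_def add_pos_nonneg)
  have vol: "(LINT x:\<Omega>|lborel. u k x) = m + 1" for k
  proof -
    have "set_integrable lborel \<Omega> (\<lambda>x. a k * f k x)"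
      by (intro set_integrable_continuous_closure S SB continuous_intros f_cont)
    then have "(LINT x:\<Omega>|lborel. u k x) = (LINT x:\<Omega>|lborel. 1) + (LINT x:\<Omega>|lborel. a k * f k x)"
      unfolding u_def using set_integrable_continuous_closure[OF S(2) SB, of "\<lambda>_. 1"]
      by (intro set_integral_add) auto
    also have "(LINT x:\<Omega>|lborel. 1) = m"
      using SB mS by (simp add: set_lebesgue_integral_def m_def)
    also have "(LINT x:\<Omega>|lborel. a k * f k x) = 1"
      using f_pos[of k] by (simp add: a_def)
    finally show ?thesis .
  qed
  have surf: "real (Suc k) / c \<le> (LINT x:frontier \<Omega>|\<mu>. u k x)" for k
  proof -
    note intF = integrable_on_compact_finite_measure[OF sets_mu compact_frontier_bounded[OF S(2)] muF]
    have "(LINT x:\<Omega>|lborel. f k x) \<le> c * (q \<bullet> e - t k) * (LINT x:frontier \<Omega>|\<mu>. f k x)"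
      unfolding f_def c_def \<mu>_def by (rule ramp_volume_le_surface[OF S e q(2) t fin])
    also have "q \<bullet> e - t k = 1 / real (Suc k)" by (simp add: t_def)
    finally have "real (Suc k) / c * (LINT x:\<Omega>|lborel. f k x)
        \<le> real (Suc k) / c * (c * (1 / real (Suc k)) * (LINT x:frontier \<Omega>|\<mu>. f k x))"
      using c by (intro mult_left_mono) auto
    also have "\<dots> = (LINT x:frontier \<Omega>|\<mu>. f k x)" using c by simp
    finally have "a k * (real (Suc k) / c * (LINT x:\<Omega>|lborel. f k x)) \<le> a k * (LINT x:frontier \<Omega>|\<mu>. f k x)"
      using a[of k] by (intro mult_left_mono) auto
    moreover have "a k * (real (Suc k) / c * (LINT x:\<Omega>|lborel. f k x)) = real (Suc k) / c"
      using f_pos[of k] by (simp add: a_def)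
    moreover have "a k * (LINT x:frontier \<Omega>|\<mu>. f k x) = (LINT x:frontier \<Omega>|\<mu>. a k * f k x)"
      by simp
    moreover have "\<dots> \<le> (LINT x:frontier \<Omega>|\<mu>. u k x)"
      by (rule set_integral_mono) (auto simp: u_def intro!: intF continuous_intros f_cont)
    ultimately show ?thesis by linarith
  qed
  have "\<not> bounded (range (\<lambda>k. 1 / H * (LINT x:frontier \<Omega>|\<mu>. u k x)))"
  proof
    assume "bounded (range (\<lambda>k. 1 / H * (LINT x:frontier \<Omega>|\<mu>. u k x)))"
    then obtain B where B: "\<And>k. norm (1 / H * (LINT x:frontier \<Omega>|\<mu>. u k x)) \<le> B"
      by (auto simp: bounded_iff)
    obtain k :: nat where k: "B * H * c < real k" using reals_Archimedean2 by blast
    have "real (Suc k) / c \<le> H * B"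
      using surf[of k] B[of k] H by (simp add: field_simps)
    then show False using k c by (simp add: field_simps)
  qed
  then have second: "\<exists>u. (\<forall>k::nat. subharmonic_on \<Omega> (u k) \<and> continuous_on (closure \<Omega>) (u k) \<and>
                 (\<forall>x\<in>closure \<Omega>. 0 < u k x)) \<and>
            bounded (range (\<lambda>k. 1 / m * (LINT x:\<Omega>|lborel. u k x))) \<and>
            \<not> bounded (range (\<lambda>k. 1 / H * (LINT x:frontier \<Omega>|\<mu>. u k x)))"
    using u_sub u_cont u_pos by (intro exI[of _ u]) (auto simp: vol)
  show ?thesis
    using first second unfolding m_def H_def \<mu>_def by (rule conjI)
qed

end
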